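(* Let $C$ be a nonempty finite set of candidates, where each candidate $c\in C$ is associated with a cost $\operatorname{cost}(c)$, let $N=\{1,\dots,n\}$ ($n\ge 1$) be a set of voters with additive utilities given by $u_i(c)\in[0,1]$ such that every voter $i$ has at least one candidate $c$ with $u_i(c)>0$, and let $b>0$ be the budget. Let $W\subseteq C$ be any set selected by the Max-Payment-Entropy Rule, i.e. $W$ maximizes $\mathrm{sc}(W')=\mathcal E(W')-\frac{n}{b}\operatorname{cost}(W')$ over all $W'\subseteq C$ and, among all maximizers of $\mathrm{sc}$, $W$ has maximal cost. Then $W$ satisfies core up-to-one: $\operatorname{cost}(W)\le b$, and for every nonempty $S\subseteq N$ and every $T\subseteq C$ with $\operatorname{cost}(T)\le b\cdot\frac{|S|}{n}$ there exists $i\in S$ such that $$u_i(T)<u_i(W)+1.$$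
   Context: For $W\subseteq C$, $\operatorname{cost}(W)=\sum_{c\in W}\operatorname{cost}(c)$ and $u_i(W)=\sum_{c\in W}u_i(c)$. For $c\in C$ put $q_c=n\cdot\operatorname{cost}(c)/b$. Loose payment systems. For $W\subseteq C$, a loose payment system consists of real payments $p_i(c)\ge 0$ ($i\in N$, $c\in W$) and remaining budgets (reserves) $r_i\ge 0$ ($i\in N$) such that (1) $r_i+\sum_{c\in W}p_i(c)=1$ for all $i\in N$; (2) $\sum_{i\in N}p_i(c)\le q_c$ for all $c\in W$; (3) $p_i(c)=0$ for all $i\in N$, $c\in W$ with $u_i(c)=0$. Let $\Phi(W)$ be the set of all loose payment systems $(p,r)$ for $W$. Weighted harmonic entropy. For a finite vector $x=(x_1,\dots,x_d)$ of nonnegative reals with $\sum_j x_j=1$ and a vector $a=(a_1,\dots,a_d)$ of positive weights, define for real $t\ge 0$ $$f_t^a(x)=\max_{\emptyset\ne J\subseteq\{1,\dots,d\}}\frac{\sum_{j\in J}x_j}{t+\sum_{j\in J}a_j}$$ (so $f_0^a(x)=\max_j x_j/a_j$), and $$F_a(x)=\sum_{\ell=0}^{\infty}\Bigl(\frac1{\ell+1}-f_\ell^a(x)\Bigr),$$ which is finite. Given $(p,r)\in\Phi(W)$, each voter $i$ has the vectors $x_i=\bigl(r_i,(p_i(c))_{c\in W:\,u_i(c)>0}\bigr)$ and $a_i=\bigl(1,(u_i(c))_{c\in W:\,u_i(c)>0}\bigr)$. The entropy of $W$ is $$\mathcal E(W)=\max_{(p,r)\in\Phi(W)}\sum_{i\in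 N}F_{a_i}(x_i).$$
   Formalization: Every cost(c) is assumed strictly positive: with two candidates of cost 0 and utility 1 and one voter, the empty set is selected and the claim fails for T = C; with negative costs the set of loose payment systems can be empty, so the entropy is undefined. *)

theory Defs
  imports Complex_Main
begin

definition cost_of :: "('c \<Rightarrow> real) \<Rightarrow> 'c set \<Rightarrow> real" where
  "cost_of cost W = (\<Sum>c\<in>W. cost c)"

definition util :: "(nat \<Rightarrow> 'c \<Rightarrow> real) \<Rightarrow> nat \<Rightarrow> 'c set \<Rightarrow> real" where
  "util u i W = (\<Sum>c\<in>W. u i c)"

text \<open>The voters are \<open>1, \<dots>, n\<close>. Only the values of \<open>p\<close> and \<open>r\<close> at voters in \<open>{1..n}\<close> and
  candidates in \<open>W\<close> carry meaning; the other values are unconstrained.\<close>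

definition loose_payment_systems ::
  "('c \<Rightarrow> real) \<Rightarrow> nat \<Rightarrow> (nat \<Rightarrow> 'c \<Rightarrow> real) \<Rightarrow> real \<Rightarrow> 'c set
    \<Rightarrow> ((nat \<Rightarrow> 'c \<Rightarrow> real) \<times> (nat \<Rightarrow> real)) set" where
  "loose_payment_systems cost n u b W = {(p, r).
     (\<forall>i\<in>{1..n}. \<forall>c\<in>W. p i c \<ge> 0) \<and>
     (\<forall>i\<in>{1..n}. r i \<ge> 0) \<and>
     (\<forall>i\<in>{1..n}. r i + (\<Sum>c\<in>W. p i c) = 1) \<and>
     (\<forall>c\<in>W. (\<Sum>i\<in>{1..n}. p i c) \<le> real n * cost c / b) \<and>
     (\<forall>i\<in>{1..n}. \<forall>c\<in>W. u i c = 0 \<longrightarrow> p i c = 0)}"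

text \<open>A finite vector is a function restricted to a finite nonempty index set \<open>I\<close>.\<close>

definition max_ratio :: "'j set \<Rightarrow> ('j \<Rightarrow> real) \<Rightarrow> ('j \<Rightarrow> real) \<Rightarrow> real \<Rightarrow> real" where
  "max_ratio I a x t = Max ((\<lambda>J. (\<Sum>j\<in>J. x j) / (t + (\<Sum>j\<in>J. a j))) ` (Pow I - {{}}))"

definition harmonic_entropy :: "'j set \<Rightarrow> ('j \<Rightarrow> real) \<Rightarrow> ('j \<Rightarrow> real) \<Rightarrow> real" where
  "harmonic_entropy I a x = (\<Sum>l. 1 / (real l + 1) - max_ratio I a x (real l))"

text \<open>The vectors \<open>x\<^sub>i\<close> and \<open>a\<^sub>i\<close> of a voter: the index \<open>None\<close> stands for the reserve (of weight 1) and
  \<open>Some c\<close> for the payment to \<open>c\<close> (of weight \<open>u i c\<close>).\<close>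

definition voter_index :: "(nat \<Rightarrow> 'c \<Rightarrow> real) \<Rightarrow> 'c set \<Rightarrow> nat \<Rightarrow> 'c option set" where
  "voter_index u W i = insert None (Some ` {c \<in> W. u i c > 0})"

definition voter_entropy ::
  "(nat \<Rightarrow> 'c \<Rightarrow> real) \<Rightarrow> 'c set \<Rightarrow> (nat \<Rightarrow> 'c \<Rightarrow> real) \<Rightarrow> (nat \<Rightarrow> real) \<Rightarrow> nat \<Rightarrow> real" where
  "voter_entropy u W p r i =
     harmonic_entropy (voter_index u W i) (case_option 1 (u i)) (case_option (r i) (p i))"

text \<open>The maximum exists: for finite \<open>W\<close> and nonnegative costs the payment systems (restricted to
  \<open>{1..n}\<close> and \<open>W\<close>) form a nonempty compact set, on which the objective is continuous.\<close>

definition entropy ::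
  "('c \<Rightarrow> real) \<Rightarrow> nat \<Rightarrow> (nat \<Rightarrow> 'c \<Rightarrow> real) \<Rightarrow> real \<Rightarrow> 'c set \<Rightarrow> real" where
  "entropy cost n u b W = (GREATEST e. \<exists>(p, r) \<in> loose_payment_systems cost n u b W.
     e = (\<Sum>i\<in>{1..n}. voter_entropy u W p r i))"

definition score ::
  "('c \<Rightarrow> real) \<Rightarrow> nat \<Rightarrow> (nat \<Rightarrow> 'c \<Rightarrow> real) \<Rightarrow> real \<Rightarrow> 'c set \<Rightarrow> real" where
  "score cost n u b W = entropy cost n u b W - real n / b * cost_of cost W"

definition score_maximizers ::
  "'c set \<Rightarrow> ('c \<Rightarrow> real) \<Rightarrow> nat \<Rightarrow> (nat \<Rightarrow> 'c \<Rightarrow> real) \<Rightarrow> real \<Rightarrow> 'c set set" where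
  "score_maximizers C cost n u b =
     {W. W \<subseteq> C \<and> (\<forall>W'. W' \<subseteq> C \<longrightarrow> score cost n u b W' \<le> score cost n u b W)}"

definition max_payment_entropy_rule ::
  "'c set \<Rightarrow> ('c \<Rightarrow> real) \<Rightarrow> nat \<Rightarrow> (nat \<Rightarrow> 'c \<Rightarrow> real) \<Rightarrow> real \<Rightarrow> 'c set set" where
  "max_payment_entropy_rule C cost n u b =
     {W \<in> score_maximizers C cost n u b.
        \<forall>W' \<in> score_maximizers C cost n u b. cost_of cost W' \<le> cost_of cost W}"

definition core_up_to_one ::
  "'c set \<Rightarrow> ('c \<Rightarrow> real) \<Rightarrow> nat \<Rightarrow> (nat \<Rightarrow> 'c \<Rightarrow> real) \<Rightarrow> real \<Rightarrow> 'c set \<Rightarrow> bool" where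
  "core_up_to_one C cost n u b W \<longleftrightarrow>
     cost_of cost W \<le> b \<and>
     (\<forall>S T. S \<subseteq> {1..n} \<longrightarrow> S \<noteq> {} \<longrightarrow> T \<subseteq> C \<longrightarrow>
        cost_of cost T \<le> b * (real (card S) / real n) \<longrightarrow>
        (\<exists>i\<in>S. util u i T < util u i W + 1))"

end

theory Submission
  imports Defs "HOL-Analysis.Analysis"
begin

text \<open>
  \<open>f_t(x)\<close> is the level \<open>\<sigma>\<close> at which the money lying above \<open>\<sigma> a\<^sub>j\<close>, summed over \<open>j\<close>, equals \<open>\<sigma> t\<close>.
  Moving money from a higher to a lower ratio \<open>x\<^sub>j / a\<^sub>j\<close> therefore lowers all \<open>f_t\<close>. Hence some optimal
  payment system satisfies \<open>p\<^sub>i(c) \<le> r\<^sub>i u\<^sub>i(c)\<close>, with equality whenever \<open>c\<close> is not fully paid for.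

  A voter who pays for a new candidate \<open>c\<close> with all money above the level \<open>f_u\<close>, \<open>u = u\<^sub>i(c)\<close>, shifts
  \<open>f_t\<close> to \<open>f_{t+u}\<close>; as \<open>f\<close> is convex in \<open>t\<close>, the entropy grows by at least \<open>u f_0 \<ge> u r\<^sub>i\<close>. By maximality
  of \<open>W\<close> and the tie-breaking, \<open>\<Sum>\<^sub>i r\<^sub>i u\<^sub>i(c) < q\<^sub>c\<close> for all \<open>c \<notin> W\<close>. If \<open>u\<^sub>i(T) \<ge> u\<^sub>i(W) + 1\<close>, then the
  payments \<open>p\<^sub>i(c)\<close> for \<open>c \<in> T \<inter> W\<close> and the prices \<open>r\<^sub>i u\<^sub>i(c)\<close> for \<open>c \<in> T - W\<close> add up to at least 1 for voter \<open>i\<close>;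
  summing over \<open>S\<close> shows that \<open>T\<close> costs more than the share of \<open>S\<close>.

  If \<open>cost(W) > b\<close>, then the unpaid costs exceed the reserves. Distribute each reserve over the
  candidates that are not fully paid for, as evenly as their unpaid costs \<open>s\<^sub>c\<close> permit. Some \<open>c\<close> then
  receives \<open>\<Sum>\<^sub>i e\<^sub>i(c) < s\<^sub>c\<close>. Removing this \<open>c\<close> and refunding \<open>p\<^sub>i(c) = r\<^sub>i u\<^sub>i(c)\<close> along \<open>u\<^sub>i(c) e\<^sub>i\<close> costs voter
  \<open>i\<close> at most \<open>p\<^sub>i(c) + e\<^sub>i(c)\<close> of entropy, in total less than \<open>q\<^sub>c\<close>: the score would increase.
\<close>

section \<open>The functions \<open>f_t\<close>\<close>

text \<open>The money above the level \<open>\<sigma>\<close>. Comparing it with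
  \<open>\<sigma> * t\<close> replaces the maximum over all subsets by a single inequality.\<close>

definition excess :: "'j set \<Rightarrow> ('j \<Rightarrow> real) \<Rightarrow> ('j \<Rightarrow> real) \<Rightarrow> real \<Rightarrow> real" where
  "excess I a x \<sigma> = (\<Sum>j\<in>I. max 0 (x j - \<sigma> * a j))"

locale weights =
  fixes I :: "'j set" and a :: "'j \<Rightarrow> real"
  assumes fin: "finite I" and ne: "I \<noteq> {}" and pos: "\<And>j. j \<in> I \<Longrightarrow> a j > 0"
begin

lemma sum_pos: "J \<subseteq> I \<Longrightarrow> J \<noteq> {} \<Longrightarrow> sum a J > 0"
  using fin pos by (intro sum_pos) (auto intro: finite_subset)

lemma max_ratio_le_iff_subsets:
  assumes "t \<ge> 0"
  shows "max_ratio I a x t \<le> \<sigma> \<longleftrightarrow> (\<forall>J. J \<subseteq> I \<longrightarrow> J \<noteq> {} \<longrightarrow> sum x J \<le> \<sigma> * (t + sum a J))"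
proof -
  have "sum x J / (t + sum a J) \<le> \<sigma> \<longleftrightarrow> sum x J \<le> \<sigma> * (t + sum a J)"
    if "J \<subseteq> I" "J \<noteq> {}" for J
    using sum_pos[OF that] assms by (simp add: field_simps)
  moreover have "Pow I - {{}} \<noteq> {}" using ne by blast
  ultimately show ?thesis
    unfolding max_ratio_def using fin by (subst Max_le_iff) auto
qed

lemma sum_le_max_ratio:
  assumes "t \<ge> 0" "J \<subseteq> I" "J \<noteq> {}"
  shows "sum x J \<le> max_ratio I a x t * (t + sum a J)"
  using max_ratio_le_iff_subsets[OF assms(1), of x "max_ratio I a x t"] assms by blast

lemma elem_le_max_ratio:
  assumes "t \<ge> 0" "j \<in> I"
  shows "x j \<le> max_ratio I a x t * (t + a j)"
  using sum_le_max_ratio[of t "{j}" x] assms by simp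

lemma max_ratio_nonneg:
  assumes "t \<ge> 0" "\<And>j. j \<in> I \<Longrightarrow> x j \<ge> 0"
  shows "max_ratio I a x t \<ge> 0"
proof -
  obtain j where j: "j \<in> I" using ne by blast
  have "0 \<le> max_ratio I a x t * (t + a j)"
    using elem_le_max_ratio[OF assms(1) j, of x] assms(2)[OF j] by simp
  then show ?thesis using pos[OF j] assms(1) by (simp add: zero_le_mult_iff)
qed

text \<open>For fixed \<open>\<sigma>\<close> the critical subset consists of the indices with
  \<open>x j > \<sigma> * a j\<close>: it maximizes \<open>sum x J - \<sigma> * sum a J\<close>, and
  this maximum is the excess.\<close>

lemma max_ratio_le_iff:
  assumes t: "t \<ge> 0" and s: "\<sigma> \<ge> 0"
  shows "max_ratio I a x t \<le> \<sigma> \<longleftrightarrow> excess I a x \<sigma> \<le> \<sigma> * t"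
proof
  assume L: "max_ratio I a x t \<le> \<sigma>"
  define J where "J = {j\<in>I. x j > \<sigma> * a j}"
  have "excess I a x \<sigma> = (\<Sum>j\<in>J. x j - \<sigma> * a j)"
    unfolding excess_def J_def using fin
    by (intro sum.mono_neutral_cong_right) (auto simp: max_def)
  also have "\<dots> = sum x J - \<sigma> * sum a J" by (simp add: sum_subtractf sum_distrib_left)
  also have "\<dots> \<le> \<sigma> * t"
  \<comment> \<open>\<open>max_ratio\<close> ranges over nonempty subsets only; an empty
    \<open>J\<close> is covered by \<open>\<sigma> * t \<ge> 0\<close>.\<close>
  proof (cases "J = {}")
    case False
    then show ?thesis using L max_ratio_le_iff_subsets[OF t, of x \<sigma>]
      by (auto simp: J_def algebra_simps)
  qed (use t s in simp)
  finally show "excess I a x \<sigma> \<le> \<sigma> * t" .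
next
  assume R: "excess I a x \<sigma> \<le> \<sigma> * t"
  show "max_ratio I a x t \<le> \<sigma>"
    unfolding max_ratio_le_iff_subsets[OF t]
  proof (intro allI impI)
    fix J assume J: "J \<subseteq> I"
    have "sum x J - \<sigma> * sum a J = (\<Sum>j\<in>J. x j - \<sigma> * a j)"
      by (simp add: sum_subtractf sum_distrib_left)
    also have "\<dots> \<le> (\<Sum>j\<in>J. max 0 (x j - \<sigma> * a j))" by (intro sum_mono) auto
    also have "\<dots> \<le> excess I a x \<sigma>"
      unfolding excess_def using J fin by (intro sum_mono2) auto
    finally show "sum x J \<le> \<sigma> * (t + sum a J)" using R by (simp add: algebra_simps)
  qed
qed

text \<open>The maximum is attained at some \<open>J\<close>, whose surplus over
  \<open>\<sigma> * sum a J\<close> is exactly \<open>\<sigma> * t\<close>. This equation for the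
  level is what later computes the shifts of f_t.\<close>

lemma excess_max_ratio:
  assumes t: "t \<ge> 0" and x: "\<And>j. j \<in> I \<Longrightarrow> x j \<ge> 0"
  shows "excess I a x (max_ratio I a x t) = max_ratio I a x t * t" (is "?e = ?\<sigma> * t")
proof (rule antisym)
  show "?e \<le> ?\<sigma> * t" by (rule iffD1[OF max_ratio_le_iff[OF t max_ratio_nonneg[OF t x]] order_refl])
  have "?\<sigma> \<in> (\<lambda>J. (\<Sum>j\<in>J. x j) / (t + (\<Sum>j\<in>J. a j))) ` (Pow I - {{}})"
    unfolding max_ratio_def using fin ne by (intro Max_in) auto
  then obtain J where J: "J \<subseteq> I" "J \<noteq> {}" "?\<sigma> = sum x J / (t + sum a J)" by auto
  have "?\<sigma> * (t + sum a J) = sum x J" using J sum_pos[OF J(1,2)] t by simp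
  then have "?\<sigma> * t = sum x J - ?\<sigma> * sum a J" by (simp add: algebra_simps)
  also have "\<dots> = (\<Sum>j\<in>J. x j - ?\<sigma> * a j)"
    by (simp add: sum_subtractf sum_distrib_left)
  also have "\<dots> \<le> (\<Sum>j\<in>J. max 0 (x j - ?\<sigma> * a j))" by (intro sum_mono) auto
  also have "\<dots> \<le> ?e" unfolding excess_def using J fin by (intro sum_mono2) auto
  finally show "?\<sigma> * t \<le> ?e" .
qed

lemma max_ratio_antimono:
  assumes "0 \<le> s" "s \<le> t" "\<And>j. j \<in> I \<Longrightarrow> x j \<ge> 0"
  shows "max_ratio I a x t \<le> max_ratio I a x s"
proof -
  have s0: "max_ratio I a x s \<ge> 0" using max_ratio_nonneg assms by simp
  have "excess I a x (max_ratio I a x s) = max_ratio I a x s * s"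
    using assms by (intro excess_max_ratio)
  also have "\<dots> \<le> max_ratio I a x s * t" using s0 assms by (intro mult_left_mono)
  finally show ?thesis using assms s0 by (subst max_ratio_le_iff) auto
qed

section \<open>Convexity of f_t in t and in x\<close>

lemma max_ratio_convex:
  assumes s: "s \<ge> 0" "t \<ge> 0" and k: "0 \<le> k" "k \<le> 1" and x: "\<And>j. j \<in> I \<Longrightarrow> x j \<ge> 0"
  shows "max_ratio I a x ((1 - k) * s + k * t)
    \<le> (1 - k) * max_ratio I a x s + k * max_ratio I a x t"
proof -
  have "sum x J \<le> ((1 - k) * max_ratio I a x s + k * max_ratio I a x t)
      * ((1 - k) * s + k * t + sum a J)"
    if J: "J \<subseteq> I" "J \<noteq> {}" for J
  proof -
    \<comment> \<open>For a fixed \<open>J\<close> the quotient \<open>X / (t + sum a J)\<close> is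
      convex in t, and a maximum of convex functions is convex.\<close>
    define X A B where "X = sum x J" and "A = s + sum a J" and "B = t + sum a J"
    have X: "X \<ge> 0" unfolding X_def using J x by (intro sum_nonneg) auto
    have AB: "A > 0" "B > 0" unfolding A_def B_def using sum_pos[OF J] s by auto
    have le: "X / A \<le> max_ratio I a x s" "X / B \<le> max_ratio I a x t"
      using sum_le_max_ratio[OF s(1) J, of x] sum_le_max_ratio[OF s(2) J, of x] AB
      by (auto simp: X_def A_def B_def field_simps)
    \<comment> \<open>AM-GM gives \<open>B / A + A / B \<ge> 2\<close>. Hence the product of
      \<open>(1 - k) / A + k / B\<close> and \<open>(1 - k) * A + k * B\<close> is at least 1, which
      is the convexity of the reciprocal.\<close>
    have "2 * (A * B) \<le> A\<^sup>2 + B\<^sup>2" using sum_squares_bound[of A B] by (simp add: power2_eq_square algebra_simps)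
    then have "2 \<le> B / A + A / B" using AB by (simp add: field_simps power2_eq_square)
    then have "k * (1 - k) * 2 \<le> k * (1 - k) * (B / A + A / B)"
      using k by (intro mult_left_mono) auto
    then have "1 \<le> (1 - k)\<^sup>2 + k\<^sup>2 + k * (1 - k) * (B / A + A / B)"
      by (simp add: power2_eq_square algebra_simps)
    also have "\<dots> = ((1 - k) / A + k / B) * ((1 - k) * A + k * B)"
      using AB by (simp add: field_simps power2_eq_square)
    finally have "X * 1 \<le> X * (((1 - k) / A + k / B) * ((1 - k) * A + k * B))"
      using X by (intro mult_left_mono)
    also have "\<dots> = ((1 - k) * (X / A) + k * (X / B)) * ((1 - k) * A + k * B)"
      unfolding mult.assoc[symmetric] by (rule arg_cong2[where f="(*)"]) (simp_all add: distrib_left mult.commute)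
    also have "\<dots> \<le> ((1 - k) * max_ratio I a x s + k * max_ratio I a x t) * ((1 - k) * A + k * B)"
      using le k AB by (intro mult_right_mono add_mono mult_left_mono) auto
    also have "(1 - k) * A + k * B = (1 - k) * s + k * t + sum a J"
      by (simp add: A_def B_def algebra_simps)
    finally show ?thesis by (simp add: X_def)
  qed
  then show ?thesis using s k by (subst max_ratio_le_iff_subsets) auto
qed

text \<open>Interpolation between \<open>t\<close> and \<open>t + 1\<close>: a shift by a weight of
  at most 1 is bounded by consecutive values, whose differences telescope.\<close>

lemma max_ratio_shift_convex:
  assumes "t \<ge> 0" "0 \<le> k" "k \<le> 1" "\<And>j. j \<in> I \<Longrightarrow> x j \<ge> 0"
  shows "max_ratio I a x (t + k) \<le> (1 - k) * max_ratio I a x t + k * max_ratio I a x (t + 1)"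
  using max_ratio_convex[of t "t + 1" k x] assms by (simp add: algebra_simps)

text \<open>For fixed \<open>t\<close> each quotient is linear in the vector, so their maximum is
  convex in it.\<close>

lemma max_ratio_mixture:
  assumes t: "t \<ge> 0" and k: "0 \<le> k" "k \<le> 1"
  shows "max_ratio I a (\<lambda>j. k * x j + (1 - k) * y j) t
    \<le> k * max_ratio I a x t + (1 - k) * max_ratio I a y t"
  unfolding max_ratio_le_iff_subsets[OF t]
proof (intro allI impI)
  fix J assume J: "J \<subseteq> I" "J \<noteq> {}"
  have "(\<Sum>j\<in>J. k * x j + (1 - k) * y j) = k * sum x J + (1 - k) * sum y J"
    by (simp add: sum.distrib sum_distrib_left)
  also have "\<dots> \<le> k * (max_ratio I a x t * (t + sum a J)) + (1 - k) * (max_ratio I a y t * (t + sum a J))"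
    using sum_le_max_ratio[OF t J] k by (intro add_mono mult_left_mono) auto
  finally show "(\<Sum>j\<in>J. k * x j + (1 - k) * y j)
    \<le> (k * max_ratio I a x t + (1 - k) * max_ratio I a y t) * (t + sum a J)"
    by (simp add: algebra_simps)
qed

lemma max_ratio_cong: "(\<And>j. j \<in> I \<Longrightarrow> x j = y j) \<Longrightarrow> max_ratio I a x t = max_ratio I a y t"
  unfolding max_ratio_def by (intro arg_cong[where f=Max] image_cong) (auto intro!: sum.cong arg_cong2[where f="(/)"])

lemma harmonic_entropy_cong:
  assumes "\<And>j. j \<in> I \<Longrightarrow> x j = y j"
  shows "harmonic_entropy I a x = harmonic_entropy I a y"
proof -
  have "max_ratio I a x t = max_ratio I a y t" for t
    using assms by (rule max_ratio_cong)
  then show ?thesis by (simp add: harmonic_entropy_def)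
qed

section \<open>Convergence and continuity of the harmonic entropy\<close>

lemma harmonic_term_bound:
  assumes x: "\<And>j. j \<in> I \<Longrightarrow> x j \<ge> 0" "sum x I = 1"
  shows "\<bar>1 / (real (Suc l) + 1) - max_ratio I a x (real (Suc l))\<bar> \<le> (1 + sum a I) * inverse (real (Suc l) ^ 2)"
proof -
  \<comment> \<open>\<open>f\<close> lies between \<open>1 / (t + A)\<close> and
    \<open>1 / t\<close>, so it differs from \<open>1 / (t + 1)\<close> by O(1/t^2), uniformly in
    \<open>x\<close>. The index \<open>Suc l\<close> keeps \<open>t\<close> positive.\<close>
  define t A f where "t = real (Suc l)" and "A = sum a I" and "f = max_ratio I a x t"
  have t: "t \<ge> 1" and A: "A > 0" using sum_pos[of I] ne by (auto simp: t_def A_def)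
  have "f \<le> 1 / t" unfolding f_def
  proof (subst max_ratio_le_iff_subsets)
    have "sum x J \<le> 1 / t * (t + sum a J)" if J: "J \<subseteq> I" "J \<noteq> {}" for J
    proof -
      have "sum x J \<le> 1" using x sum_mono2[OF fin J(1), of x] J by auto
      also have "1 \<le> 1 / t * (t + sum a J)" using t sum_pos[OF J] by (simp add: field_simps)
      finally show ?thesis .
    qed
    then show "\<forall>J. J \<subseteq> I \<longrightarrow> J \<noteq> {} \<longrightarrow> sum x J \<le> 1 / t * (t + sum a J)" by blast
  qed (use t in auto)
  moreover have "1 / (t + A) \<le> f"
    using sum_le_max_ratio[of t I x] x ne t A by (simp add: f_def A_def field_simps)
  moreover have "1 / t - 1 / (t + 1) \<le> (1 + A) / t\<^sup>2"
  proof -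
    have "1 / t - 1 / (t + 1) = 1 / (t * (t + 1))" using t by (simp add: field_simps)
    also have "\<dots> \<le> (1 + A) / (t * t)" using t A by (intro frac_le mult_left_mono) auto
    finally show ?thesis by (simp add: power2_eq_square)
  qed
  moreover have "1 / (t + 1) - 1 / (t + A) \<le> 1 / t - 1 / (t + A)"
    using t by (simp add: field_simps)
  moreover have "1 / t - 1 / (t + A) = A / (t * (t + A))" using t A by (simp add: field_simps)
  moreover have "A / (t * (t + A)) \<le> (1 + A) / t\<^sup>2"
    unfolding power2_eq_square using t A by (intro frac_le mult_left_mono) auto
  ultimately have "\<bar>1 / (t + 1) - f\<bar> \<le> (1 + A) / t\<^sup>2" by linarith
  then show ?thesis by (simp add: t_def A_def f_def divide_inverse)
qed

lemma summable_harmonic: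
  assumes "\<And>j. j \<in> I \<Longrightarrow> x j \<ge> 0" "sum x I = 1"
  shows "summable (\<lambda>l. 1 / (real l + 1) - max_ratio I a x (real l))"
proof -
  have "summable (\<lambda>l. (1 + sum a I) * inverse (real (Suc l) ^ 2))"
    by (intro summable_mult iffD2[OF summable_Suc_iff] inverse_power_summable) auto
  then have "summable (\<lambda>l. 1 / (real (Suc l) + 1) - max_ratio I a x (real (Suc l)))"
    by (rule summable_comparison_test') (use harmonic_term_bound[OF assms] in auto)
  then show ?thesis by (subst (asm) summable_Suc_iff)
qed

lemma max_ratio_tendsto_0:
  assumes "\<And>j. j \<in> I \<Longrightarrow> x j \<ge> 0" "sum x I = 1"
  shows "(\<lambda>l. max_ratio I a x (real l)) \<longlonglongrightarrow> 0"
proof -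
  have "(\<lambda>l. 1 / (real l + 1)) \<longlonglongrightarrow> 0"
    using LIMSEQ_inverse_real_of_nat by (simp add: inverse_eq_divide add.commute)
  from tendsto_diff[OF this summable_LIMSEQ_zero[OF summable_harmonic[OF assms]]]
  show ?thesis by simp
qed

text \<open>Turns termwise bounds by differences of consecutive values into a bound by f_0, the
  quantity that controls gains and losses of entropy.\<close>

lemma telescope_max_ratio:
  assumes "\<And>j. j \<in> I \<Longrightarrow> x j \<ge> 0" "sum x I = 1"
  shows "(\<lambda>l. max_ratio I a x (real l) - max_ratio I a x (real l + 1)) sums max_ratio I a x 0"
  using telescope_sums'[OF max_ratio_tendsto_0[OF assms]] by (simp add: add.commute)

lemma continuous_on_max_ratio:
  fixes x :: "'b::topological_space \<Rightarrow> 'j \<Rightarrow> real"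
  assumes t: "t \<ge> 0" and z: "\<And>j. j \<in> I \<Longrightarrow> continuous_on K (\<lambda>z. x z j)"
  shows "continuous_on K (\<lambda>z. max_ratio I a (x z) t)"
proof -
  have *: "continuous_on K (\<lambda>z. Max ((\<lambda>J. g J z) ` \<J>))"
    if "finite \<J>" "\<J> \<noteq> {}" "\<And>J. J \<in> \<J> \<Longrightarrow> continuous_on K (g J)"
    for \<J> :: "'j set set" and g :: "'j set \<Rightarrow> 'b \<Rightarrow> real"
    using that
  proof (induction rule: finite_ne_induct)
    case (insert J \<J>)
    have "continuous_on K (\<lambda>z. max (g J z) (Max ((\<lambda>J. g J z) ` \<J>)))"
      using insert by (intro continuous_on_max) auto
    then show ?case using insert by simp
  qed simp
  show ?thesis unfolding max_ratio_def
  proof (rule *)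
    fix J assume "J \<in> Pow I - {{}}"
    then show "continuous_on K (\<lambda>z. sum (x z) J / (t + sum a J))"
      using sum_pos[of J] t z
      by (intro continuous_on_divide continuous_on_sum continuous_on_const) auto
  qed (use fin ne in auto)
qed

text \<open>Weierstrass M-test with the quadratic bound, which is uniform in the vector. The term of
  index 0 lies outside that bound and is added separately.\<close>

lemma continuous_on_harmonic_entropy:
  fixes x :: "'b::topological_space \<Rightarrow> 'j \<Rightarrow> real"
  assumes z: "\<And>j. j \<in> I \<Longrightarrow> continuous_on K (\<lambda>z. x z j)"
    and x: "\<And>z j. z \<in> K \<Longrightarrow> j \<in> I \<Longrightarrow> x z j \<ge> 0" "\<And>z. z \<in> K \<Longrightarrow> sum (x z) I = 1"
  shows "continuous_on K (\<lambda>z. harmonic_entropy I a (x z))"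
proof -
  define g where "g l z = 1 / (real l + 1) - max_ratio I a (x z) (real l)" for l z
  have gc: "continuous_on K (g l)" for l
    unfolding g_def by (intro continuous_intros continuous_on_max_ratio z) auto
  have "uniform_limit K (\<lambda>n z. \<Sum>l<n. g (Suc l) z) (\<lambda>z. \<Sum>l. g (Suc l) z) sequentially"
  proof (rule Weierstrass_m_test)
    show "summable (\<lambda>l. (1 + sum a I) * inverse (real (Suc l) ^ 2))"
      by (intro summable_mult iffD2[OF summable_Suc_iff] inverse_power_summable) auto
  qed (use harmonic_term_bound x in \<open>auto simp: g_def\<close>)
  then have "continuous_on K (\<lambda>z. \<Sum>l. g (Suc l) z)"
    by (rule uniform_limit_theorem[rotated]) (auto intro!: always_eventually continuous_on_sum gc)
  then have "continuous_on K (\<lambda>z. (\<Sum>l. g (Suc l) z) + g 0 z)"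
    by (intro continuous_on_add gc)
  moreover have "harmonic_entropy I a (x z) = (\<Sum>l. g (Suc l) z) + g 0 z" if "z \<in> K" for z
  proof -
    have "summable (\<lambda>l. g l z)" unfolding g_def using x that by (intro summable_harmonic) auto
    from suminf_split_head[OF this] show ?thesis by (simp add: harmonic_entropy_def g_def)
  qed
  ultimately show ?thesis by (simp cong: continuous_on_cong)
qed

end

section \<open>Moves of a single voter\<close>

text \<open>At the level \<open>\<sigma>\<close> either \<open>k\<close> stays below it after the
  transfer and gains no excess, or both \<open>j\<close> and \<open>k\<close> end above it; neither
  case increases their joint excess.\<close>

lemma (in weights) max_ratio_transfer:
  assumes t: "t \<ge> 0" and x: "\<And>i. i \<in> I \<Longrightarrow> x i \<ge> 0" and jk: "j \<in> I" "k \<in> I" "j \<noteq> k"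
    and d: "0 \<le> \<delta>" "(x k + \<delta>) / a k \<le> (x j - \<delta>) / a j"
  shows "max_ratio I a (x(j := x j - \<delta>, k := x k + \<delta>)) t \<le> max_ratio I a x t"
proof -
  let ?y = "x(j := x j - \<delta>, k := x k + \<delta>)"
  define \<sigma> where "\<sigma> = max_ratio I a x t"
  have s0: "\<sigma> \<ge> 0" unfolding \<sigma>_def by (rule max_ratio_nonneg[OF t x])
  have split: "excess I a z \<sigma> = (\<Sum>i\<in>I - {j, k}. max 0 (z i - \<sigma> * a i))
      + max 0 (z j - \<sigma> * a j) + max 0 (z k - \<sigma> * a k)" for z
    unfolding excess_def using sum.subset_diff[of "{j, k}" I "\<lambda>i. max 0 (z i - \<sigma> * a i)"] fin jk by simp
  have a: "a j > 0" "a k > 0" using pos jk by auto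
  have "max 0 (x j - \<delta> - \<sigma> * a j) + max 0 (x k + \<delta> - \<sigma> * a k)
      \<le> max 0 (x j - \<sigma> * a j) + max 0 (x k - \<sigma> * a k)"
  proof (cases "x k + \<delta> \<le> \<sigma> * a k")
    case False
    then have "\<sigma> < (x k + \<delta>) / a k" using a by (simp add: field_simps)
    then have "\<sigma> < (x j - \<delta>) / a j" using d by linarith
    then have "\<sigma> * a j < x j - \<delta>" using a by (simp add: field_simps)
    then show ?thesis using d by (simp add: max_def)
  qed (use d in \<open>simp add: max_def\<close>)
  moreover have "(\<Sum>i\<in>I - {j, k}. max 0 (?y i - \<sigma> * a i)) = (\<Sum>i\<in>I - {j, k}. max 0 (x i - \<sigma> * a i))"
    by (intro sum.cong) auto
  ultimately have "excess I a ?y \<sigma> \<le> excess I a x \<sigma>"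
    unfolding split using jk by simp
  also have "\<dots> = \<sigma> * t" unfolding \<sigma>_def by (rule excess_max_ratio[OF t x])
  finally have "max_ratio I a ?y t \<le> \<sigma>" using s0 t by (subst max_ratio_le_iff) auto
  then show ?thesis by (simp add: \<sigma>_def)
qed

lemma (in weights) harmonic_entropy_mono:
  assumes x: "\<And>j. j \<in> I \<Longrightarrow> x j \<ge> 0" "sum x I = 1" and y: "\<And>j. j \<in> I \<Longrightarrow> y j \<ge> 0" "sum y I = 1"
    and le: "\<And>t. t \<ge> 0 \<Longrightarrow> max_ratio I a y t \<le> max_ratio I a x t"
  shows "harmonic_entropy I a x \<le> harmonic_entropy I a y"
  unfolding harmonic_entropy_def
  by (intro suminf_le summable_harmonic x y diff_left_mono le) auto

text \<open>The bound \<open>a c \<le> 1\<close> allows a shift by \<open>a c\<close> to be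
  interpolated between consecutive integers. \<open>I\<close> is kept nonempty so that
  \<open>max_ratio\<close> over \<open>I\<close> is meaningful without \<open>c\<close>.\<close>

locale added_item = weights "insert c I" a for I :: "'j set" and c :: 'j and a :: "'j \<Rightarrow> real" +
  assumes new: "c \<notin> I" and old_ne: "I \<noteq> {}" and small: "a c \<le> 1"
begin

sublocale old: weights I a
  using fin pos old_ne by unfold_locales auto

lemma excess_insert: "excess (insert c I) a x \<sigma> = max 0 (x c - \<sigma> * a c) + excess I a x \<sigma>"
  unfolding excess_def using old.fin new by simp

lemma sum_insert: "sum x (insert c I) = x c + sum x I"
  using old.fin new by simp

text \<open>The new item is paid with everything above the level \<open>\<sigma> = f_{a c}\<close>; this shifts \<open>f\<close> by \<open>a c\<close>.\<close>

definition pay :: "('j \<Rightarrow> real) \<Rightarrow> 'j \<Rightarrow> real" where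
  "pay x = (let \<sigma> = max_ratio I a x (a c) in (\<lambda>j. if j = c then \<sigma> * a c else min (x j) (\<sigma> * a j)))"

lemma pay_new: "pay x c = max_ratio I a x (a c) * a c"
  by (simp add: pay_def Let_def)

context
  fixes x :: "'j \<Rightarrow> real"
  assumes x: "\<And>j. j \<in> I \<Longrightarrow> x j \<ge> 0" "sum x I = 1"
begin

lemma ac: "a c > 0" using pos by simp

lemma level_nonneg: "max_ratio I a x (a c) \<ge> 0"
  using old.max_ratio_nonneg[of "a c" x] ac x by simp

lemma pay_nonneg: "j \<in> insert c I \<Longrightarrow> pay x j \<ge> 0"
  using level_nonneg x pos[of j] by (auto simp: pay_def Let_def)

lemma pay_le: "j \<in> I \<Longrightarrow> pay x j \<le> x j"
  using new by (auto simp: pay_def Let_def)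

text \<open>Capping every entry at the paying level cuts off exactly the excess at that level,
  without touching anything below it.\<close>

lemma excess_pay_old:
  assumes "\<sigma> \<le> max_ratio I a x (a c)"
  shows "excess I a (pay x) \<sigma> = excess I a x \<sigma> - pay x c"
proof -
  let ?\<rho> = "max_ratio I a x (a c)"
  have "excess I a x ?\<rho> = pay x c"
    using old.excess_max_ratio[of "a c" x] ac x by (simp add: pay_new)
  moreover have "excess I a (pay x) \<sigma> = excess I a x \<sigma> - excess I a x ?\<rho>"
    unfolding excess_def sum_subtractf[symmetric]
  proof (rule sum.cong)
    fix j assume j: "j \<in> I"
    have "\<sigma> * a j \<le> ?\<rho> * a j" using assms pos[of j] j by (intro mult_right_mono) auto
    then show "max 0 (pay x j - \<sigma> * a j) = max 0 (x j - \<sigma> * a j) - max 0 (x j - ?\<rho> * a j)"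
      using j new by (auto simp: pay_def Let_def max_def min_def)
  qed simp
  ultimately show ?thesis by simp
qed

text \<open>The amount cut off is the excess at the level for \<open>t = a c\<close>, and by the
  level equation this is the amount that \<open>c\<close> receives.\<close>

lemma sum_pay: "sum (pay x) (insert c I) = 1"
proof -
  let ?\<rho> = "max_ratio I a x (a c)"
  have "sum (pay x) I = sum x I - excess I a x ?\<rho>"
    unfolding excess_def sum_subtractf[symmetric]
    using new by (intro sum.cong) (auto simp: pay_def Let_def max_def min_def)
  moreover have "excess I a x ?\<rho> = pay x c"
    using old.excess_max_ratio[of "a c" x] ac x by (simp add: pay_new)
  ultimately show ?thesis using x by (simp add: sum_insert)
qed

text \<open>At the level for \<open>t + a c\<close> the old items have lost \<open>pay x c\<close>
  of excess, while \<open>c\<close> contributes \<open>pay x c\<close> minus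
  \<open>\<sigma> * a c\<close>. The excess drops from \<open>\<sigma> * (t + a c)\<close> to
  \<open>\<sigma> * t\<close>.\<close>

lemma max_ratio_pay:
  assumes t: "t \<ge> 0"
  shows "max_ratio (insert c I) a (pay x) t \<le> max_ratio I a x (t + a c)"
proof -
  let ?\<rho> = "max_ratio I a x (a c)" and ?\<sigma> = "max_ratio I a x (t + a c)"
  have s: "?\<sigma> \<le> ?\<rho>" using t ac x by (intro old.max_ratio_antimono) auto
  have s0: "?\<sigma> \<ge> 0" using t ac x by (intro old.max_ratio_nonneg) auto
  have "?\<sigma> * a c \<le> pay x c" using s ac by (simp add: pay_new)
  then have "excess (insert c I) a (pay x) ?\<sigma> = excess I a x ?\<sigma> - ?\<sigma> * a c"
    by (simp add: excess_insert excess_pay_old[OF s])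
  also have "\<dots> = ?\<sigma> * t"
    using old.excess_max_ratio[of "t + a c" x] t ac x by (simp add: algebra_simps)
  finally show ?thesis using t s0 by (subst max_ratio_le_iff) auto
qed

lemma max_ratio_unpaid:
  assumes t: "t \<ge> 0"
  shows "max_ratio (insert c I) a (x(c := 0)) t \<le> max_ratio I a x t"
proof -
  let ?\<sigma> = "max_ratio I a x t"
  have s0: "?\<sigma> \<ge> 0" using t x by (intro old.max_ratio_nonneg) auto
  have "excess I a (x(c := 0)) ?\<sigma> = excess I a x ?\<sigma>"
    unfolding excess_def using new by (intro sum.cong) auto
  then have "excess (insert c I) a (x(c := 0)) ?\<sigma> = ?\<sigma> * t"
    using old.excess_max_ratio[of t x] t x s0 ac by (simp add: excess_insert)
  then show ?thesis using t s0 by (subst max_ratio_le_iff) auto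
qed

text \<open>Scaling the payments for the new item down to a fraction \<open>\<theta>\<close> costs at most the
  fraction \<open>1 - \<theta>\<close> of the gain, because \<open>f_t\<close> is convex in \<open>x\<close>.\<close>

lemma harmonic_entropy_gain:
  assumes th: "0 \<le> \<theta>" "\<theta> \<le> 1"
  defines "y \<equiv> \<lambda>j. \<theta> * pay x j + (1 - \<theta>) * (x(c := 0)) j"
  shows "harmonic_entropy I a x + \<theta> * (a c * max_ratio I a x 0) \<le> harmonic_entropy (insert c I) a y"
    and "\<And>j. j \<in> insert c I \<Longrightarrow> y j \<ge> 0" and "sum y (insert c I) = 1"
    and "\<And>j. j \<in> I \<Longrightarrow> y j \<le> x j"
proof -
  let ?f = "\<lambda>l. max_ratio I a x (real l)" and ?g = "\<lambda>l. max_ratio (insert c I) a y (real l)"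
  show y0: "\<And>j. j \<in> insert c I \<Longrightarrow> y j \<ge> 0"
    unfolding y_def using th x pay_nonneg new by (intro add_nonneg_nonneg mult_nonneg_nonneg) auto
  have "sum (x(c := 0)) (insert c I) = 1"
  proof -
    have "sum (x(c := 0)) I = sum x I" using new by (intro sum.cong) auto
    then show ?thesis using x by (simp add: sum_insert)
  qed
  then show y1: "sum y (insert c I) = 1"
    unfolding y_def by (simp only: sum.distrib sum_distrib_left[symmetric] sum_pay) simp
  show "y j \<le> x j" if j: "j \<in> I" for j
  proof -
    have "\<theta> * pay x j \<le> \<theta> * x j" using pay_le[OF j] th by (intro mult_left_mono)
    then show ?thesis using j new by (auto simp: y_def algebra_simps)
  qed
  \<comment> \<open>Mixture, shift by \<open>a c\<close> and interpolation bound each term by a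
    difference of consecutive values; the sum telescopes to f_0.\<close>
  have step: "\<theta> * a c * (?f l - max_ratio I a x (real l + 1)) \<le> ?f l - ?g l" for l
  proof -
    have "?g l \<le> \<theta> * max_ratio (insert c I) a (pay x) l + (1 - \<theta>) * max_ratio (insert c I) a (x(c := 0)) l"
      unfolding y_def using th by (intro max_ratio_mixture) auto
    also have "\<dots> \<le> \<theta> * max_ratio I a x (real l + a c) + (1 - \<theta>) * ?f l"
      using th by (intro add_mono mult_left_mono max_ratio_pay max_ratio_unpaid) auto
    also have "\<dots> \<le> \<theta> * ((1 - a c) * ?f l + a c * max_ratio I a x (real l + 1)) + (1 - \<theta>) * ?f l"
      using th ac small x by (intro add_right_mono mult_left_mono old.max_ratio_shift_convex) auto
    finally show ?thesis by (simp add: algebra_simps)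
  qed
  have sums: "(\<lambda>l. ?f l - ?g l) sums (harmonic_entropy (insert c I) a y - harmonic_entropy I a x)"
    using sums_diff[OF summable_sums[OF summable_harmonic[OF y0 y1]] summable_sums[OF old.summable_harmonic[OF x]]]
    by (simp add: harmonic_entropy_def)
  have "\<theta> * a c * ?f 0 \<le> harmonic_entropy (insert c I) a y - harmonic_entropy I a x"
    using sums_le[OF step sums_mult[OF old.telescope_max_ratio[OF x]] sums] by simp
  then show "harmonic_entropy I a x + \<theta> * (a c * max_ratio I a x 0) \<le> harmonic_entropy (insert c I) a y"
    by simp
qed

end

text \<open>If only items of the top ratio \<open>\<rho>\<close> receive a refund \<open>y\<close>, then removing \<open>c\<close> shifts \<open>f\<close> by
  \<open>- a c\<close>, except for \<open>f_0\<close>.\<close>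

lemma harmonic_entropy_loss:
  assumes x: "\<And>j. j \<in> insert c I \<Longrightarrow> x j \<ge> 0" "sum x (insert c I) = 1"
    and top: "\<And>j. j \<in> I \<Longrightarrow> x j \<le> \<rho> * a j" "x c = \<rho> * a c"
    and y: "\<And>j. j \<in> I \<Longrightarrow> y j \<ge> 0" "\<And>j. j \<in> I \<Longrightarrow> y j \<noteq> 0 \<Longrightarrow> x j = \<rho> * a j" "sum y I = x c"
    and M: "\<And>j. j \<in> I \<Longrightarrow> y j \<le> M * a j" "M \<ge> 0"
  shows "harmonic_entropy (insert c I) a x \<le> harmonic_entropy I a (\<lambda>j. x j + y j) + (x c + M)"
proof -
  let ?z = "\<lambda>j. x j + y j"
  let ?f = "\<lambda>l. max_ratio (insert c I) a x (real l)" and ?g = "\<lambda>l. max_ratio I a ?z (real l)"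
  have ac: "a c > 0" using pos by simp
  have rho: "\<rho> \<ge> 0" using x(1)[of c] top(2) ac by (simp add: zero_le_mult_iff)
  have z: "\<And>j. j \<in> I \<Longrightarrow> ?z j \<ge> 0" "sum ?z I = 1"
    using x y by (auto simp: sum.distrib sum_insert)
  have f0: "?f 0 \<le> \<rho>"
  proof -
    have "max 0 (x j - \<rho> * a j) = 0" if "j \<in> insert c I" for j
      using top that by (cases "j = c") auto
    then have "excess (insert c I) a x \<rho> = 0" by (simp add: excess_def)
    then show ?thesis using rho by (subst max_ratio_le_iff) auto
  qed
  have f0': "?f 0 = \<rho>"
    using f0 elem_le_max_ratio[of 0 c x] top(2) ac by auto
  \<comment> \<open>A refund of at most \<open>M * a j\<close> raises the top ratio by at most
    \<open>M\<close>. The index 0 is treated apart because the shift by \<open>- a c\<close> would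
    leave the range of nonnegative arguments.\<close>
  have g0: "?g 0 \<le> \<rho> + M"
  proof -
    have "excess I a ?z (\<rho> + M) = 0"
      unfolding excess_def using top M by (intro sum.neutral ballI) (fastforce simp: max_def algebra_simps)
    then show ?thesis using rho M by (subst old.max_ratio_le_iff) auto
  qed
  \<comment> \<open>From index 1 on the shifted argument is
    \<open>Suc l - a c = l + (1 - a c)\<close>, between \<open>l\<close> and
    \<open>l + 1\<close>.\<close>
  have step: "?g (Suc l) - ?f (Suc l) \<le> a c * (?f l - max_ratio (insert c I) a x (real l + 1))" for l
  proof -
    let ?\<sigma> = "max_ratio (insert c I) a x (real l + (1 - a c))"
    have s0: "?\<sigma> \<ge> 0" using small x by (intro max_ratio_nonneg) auto
    have "?\<sigma> \<le> ?f 0" using small x by (intro max_ratio_antimono) auto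
    then have s: "?\<sigma> * a j \<le> \<rho> * a j" if "j \<in> insert c I" for j
      using f0 pos[OF that] by simp
    \<comment> \<open>Refunded items sit at the top ratio, hence not below this level, so each
      refund counts in full as excess.\<close>
    have "excess I a ?z ?\<sigma> = excess I a x ?\<sigma> + sum y I"
      unfolding excess_def sum.distrib[symmetric]
    proof (rule sum.cong)
      fix j assume j: "j \<in> I"
      show "max 0 (x j + y j - ?\<sigma> * a j) = max 0 (x j - ?\<sigma> * a j) + y j"
        using y(1,2)[OF j] s[of j] j by (cases "y j = 0") auto
    qed simp
    also have "\<dots> = excess (insert c I) a x ?\<sigma> + ?\<sigma> * a c"
      using s[of c] y(3) top(2) by (simp add: excess_insert)
    also have "\<dots> = ?\<sigma> * real (Suc l)"
      using excess_max_ratio[of "real l + (1 - a c)" x] small x by (simp add: algebra_simps)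
    finally have "?g (Suc l) \<le> ?\<sigma>" using s0 by (subst old.max_ratio_le_iff) auto
    also have "\<dots> \<le> (1 - (1 - a c)) * ?f l + (1 - a c) * max_ratio (insert c I) a x (real l + 1)"
      using ac small x by (intro max_ratio_shift_convex) auto
    finally show ?thesis by (simp add: algebra_simps)
  qed
  have sums: "(\<lambda>l. ?g l - ?f l) sums (harmonic_entropy (insert c I) a x - harmonic_entropy I a ?z)"
    using sums_diff[OF summable_sums[OF summable_harmonic[OF x]] summable_sums[OF old.summable_harmonic[OF z]]]
    by (simp add: harmonic_entropy_def)
  \<comment> \<open>The terms from index 1 on telescope to at most \<open>a c * ?f 0\<close>, which
    equals \<open>x c\<close>; the term of index 0 adds at most \<open>M\<close>.\<close>
  then have "(\<lambda>l. ?g (Suc l) - ?f (Suc l)) sums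
      (harmonic_entropy (insert c I) a x - harmonic_entropy I a ?z - (?g 0 - ?f 0))"
    by (subst sums_Suc_iff) simp
  from sums_le[OF step this sums_mult[OF telescope_max_ratio[OF x]]]
  have "harmonic_entropy (insert c I) a x - harmonic_entropy I a ?z - (?g 0 - ?f 0) \<le> a c * ?f 0"
    by simp
  then show ?thesis using g0 f0' top(2) by (simp add: mult.commute)
qed

end

section \<open>Balanced allocations\<close>

text \<open>Tychonoff in the product topology; the index type may be infinite.\<close>

lemma compact_box: "compact {z :: 'i \<Rightarrow> real. \<forall>i. 0 \<le> z i \<and> z i \<le> B i}"
proof -
  have "compactin (product_topology (\<lambda>i. euclidean) UNIV) (PiE UNIV (\<lambda>i. {0..B i}))"
    by (subst compactin_PiE) auto
  moreover have "PiE UNIV (\<lambda>i. {0..B i}) = {z. \<forall>i. 0 \<le> z i \<and> z i \<le> B i}"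
    by auto
  ultimately show ?thesis by (simp add: euclidean_product_topology)
qed

lemma continuous_on_proj: "continuous_on S (\<lambda>z :: 'i \<Rightarrow> real. z i)"
  by (rule continuous_on_product_then_coordinatewise[OF continuous_on_id])

text \<open>The maximizers of \<open>f\<close> form a closed, hence compact, subset of
  \<open>K\<close>. The second objective selects a balanced optimum where equalizing transfers
  improve the entropy only weakly.\<close>

lemma lexicographic_optimum:
  fixes f g :: "'a::topological_space \<Rightarrow> real"
  assumes K: "compact K" "K \<noteq> {}" and f: "continuous_on K f" and g: "continuous_on K g"
  obtains z where "z \<in> K" "\<And>y. y \<in> K \<Longrightarrow> f y \<le> f z"
    "\<And>y. y \<in> K \<Longrightarrow> f y = f z \<Longrightarrow> g z \<le> g y"
proof -
  obtain m where m: "m \<in> K" "\<And>y. y \<in> K \<Longrightarrow> f y \<le> f m"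
    using continuous_attains_sup[OF K f] by blast
  define L where "L = K \<inter> f -` {f m..}"
  have "closedin (top_of_set K) L"
    unfolding L_def by (intro continuous_closedin_preimage f closed_atLeast)
  then have "compact L" using K closedin_compact by blast
  moreover have "L \<noteq> {}" "continuous_on L g"
    using m g by (auto simp: L_def intro: continuous_on_subset)
  ultimately have "\<exists>z\<in>L. \<forall>y\<in>L. g z \<le> g y" by (rule continuous_attains_inf)
  then obtain z where z: "z \<in> L" "\<And>y. y \<in> L \<Longrightarrow> g z \<le> g y" by blast
  have "f z = f m" using z(1) m by (auto simp: L_def intro: antisym)
  then show thesis using z m by (intro that[of z]) (auto simp: L_def)
qed

text \<open>\<open>x\<^sup>2 / a\<close> has derivative \<open>2 * x / a\<close>, so moving money
  from a higher to a lower ratio strictly decreases the sum.\<close>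

lemma quadratic_transfer:
  fixes a b :: real
  assumes "a > 0" "b > 0" "\<delta> > 0" "(y + \<delta>) / b \<le> (x - \<delta>) / a"
  shows "(x - \<delta>)\<^sup>2 / a + (y + \<delta>)\<^sup>2 / b < x\<^sup>2 / a + y\<^sup>2 / b"
proof -
  have "\<delta> * ((2 * y + \<delta>) / b) < \<delta> * ((2 * x - \<delta>) / a)"
  proof (rule mult_strict_left_mono)
    have "(2 * y + \<delta>) / b < 2 * ((y + \<delta>) / b)" using assms by (simp add: field_simps)
    also have "\<dots> \<le> 2 * ((x - \<delta>) / a)" by (intro mult_left_mono assms) simp
    also have "\<dots> < (2 * x - \<delta>) / a" using assms by (simp add: field_simps)
    finally show "(2 * y + \<delta>) / b < (2 * x - \<delta>) / a" .
  qed fact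
  moreover have "x\<^sup>2 / a - (x - \<delta>)\<^sup>2 / a = \<delta> * ((2 * x - \<delta>) / a)"
    by (simp add: diff_divide_distrib[symmetric] power2_eq_square algebra_simps)
  moreover have "(y + \<delta>)\<^sup>2 / b - y\<^sup>2 / b = \<delta> * ((2 * y + \<delta>) / b)"
    by (simp add: diff_divide_distrib[symmetric] power2_eq_square algebra_simps)
  ultimately show ?thesis by linarith
qed

lemma small_transfer:
  fixes a b :: real
  assumes a: "a > 0" "b > 0" and less: "y / b < x / a" and y: "y \<ge> 0" and e: "\<epsilon> > 0"
  obtains \<delta> where "\<delta> > 0" "\<delta> \<le> \<epsilon>" "\<delta> \<le> x" "(y + \<delta>) / b \<le> (x - \<delta>) / a"
proof -
  \<comment> \<open>\<open>D\<close> is the transfer that makes both ratios equal.\<close>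
  define D where "D = (x * b - y * a) / (a + b)"
  define \<delta> where "\<delta> = min \<epsilon> D"
  have D: "D > 0" using less a by (simp add: D_def field_simps)
  have D': "D * (a + b) = x * b - y * a" using a by (simp add: D_def)
  have "\<delta> * (a + b) \<le> D * (a + b)" using a by (intro mult_right_mono) (auto simp: \<delta>_def)
  then have *: "(y + \<delta>) * a \<le> (x - \<delta>) * b" using D' by (simp add: algebra_simps)
  then have "(y + \<delta>) / b \<le> (x - \<delta>) / a" using a by (simp add: field_simps)
  moreover have "\<delta> > 0" using D e by (simp add: \<delta>_def)
  moreover have "0 \<le> (y + \<delta>) * a" using y a \<open>\<delta> > 0\<close> by simp
  then have "0 \<le> (x - \<delta>) * b" using * by linarith
  then have "\<delta> \<le> x" using a by (simp add: zero_le_mult_iff)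
  ultimately show thesis by (intro that[of \<delta>]) (auto simp: \<delta>_def)
qed

lemma sum_fun_upd2:
  fixes g :: "'i \<Rightarrow> real"
  assumes "finite A" "j \<in> A" "k \<in> A" "j \<noteq> k"
  shows "(\<Sum>i\<in>A. h i ((x(j := v, k := w)) i)) = (\<Sum>i\<in>A. h i (x i)) + (h j v - h j (x j)) + (h k w - h k (x k) :: real)"
proof -
  have "(\<Sum>i\<in>A - {j, k}. h i ((x(j := v, k := w)) i)) = (\<Sum>i\<in>A - {j, k}. h i (x i))"
    by (intro sum.cong) auto
  moreover have "sum g A = sum g (A - {j, k}) + g j + g k" for g :: "_ \<Rightarrow> real"
    using sum.subset_diff[of "{j, k}" A g] assms by simp
  ultimately show ?thesis using assms by simp
qed

lemma sum_fun_upd1: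
  assumes "finite A" "j \<in> A"
  shows "(\<Sum>i\<in>A. h i ((x(j := v)) i)) = (\<Sum>i\<in>A. h i (x i)) + (h j v - h j (x j) :: real)"
proof -
  have "(\<Sum>i\<in>A - {j}. h i ((x(j := v)) i)) = (\<Sum>i\<in>A - {j}. h i (x i))"
    by (intro sum.cong) auto
  then show ?thesis using assms by (simp add: sum.remove)
qed

text \<open>A maximizer of a concave potential spends as much as possible, and spreads the spending of
  each \<open>i\<close> as evenly (relative to \<open>u i\<close>) as the capacities \<open>s\<close> permit.\<close>

lemma balanced_allocation:
  fixes u :: "'i \<Rightarrow> 'j \<Rightarrow> real" and r :: "'i \<Rightarrow> real" and s :: "'j \<Rightarrow> real"
  assumes fin: "finite N" "finite U"
    and u: "\<And>i j. i \<in> N \<Longrightarrow> j \<in> U \<Longrightarrow> u i j \<ge> 0"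
    and r: "\<And>i. i \<in> N \<Longrightarrow> r i \<ge> 0" and s: "\<And>j. j \<in> U \<Longrightarrow> s j \<ge> 0"
  obtains e where
    "\<And>i j. e i j \<ge> 0"
    "\<And>i j. i \<in> N \<Longrightarrow> j \<in> U \<Longrightarrow> u i j = 0 \<Longrightarrow> e i j = 0"
    "\<And>i. i \<in> N \<Longrightarrow> (\<Sum>j\<in>U. e i j) \<le> r i"
    "\<And>j. j \<in> U \<Longrightarrow> (\<Sum>i\<in>N. e i j) \<le> s j"
    "\<And>i c. i \<in> N \<Longrightarrow> c \<in> U \<Longrightarrow> (\<Sum>i\<in>N. e i c) < s c \<Longrightarrow> u i c > 0 \<Longrightarrow> (\<Sum>j\<in>U. e i j) = r i"
    "\<And>i c j. i \<in> N \<Longrightarrow> c \<in> U \<Longrightarrow> (\<Sum>i\<in>N. e i c) < s c \<Longrightarrow> u i c > 0 \<Longrightarrow> j \<in> U \<Longrightarrow>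
      e i j * u i c \<le> u i j * e i c"
proof -
  \<comment> \<open>The value 0 encodes the support condition, and \<open>cap\<close> bounds every
    coordinate, which puts \<open>K\<close> inside a compact box.\<close>
  define cap where "cap = (\<lambda>(i, j). if i \<in> N \<and> j \<in> U \<and> u i j > 0 then r i else 0)"
  define K where "K = {z. \<forall>k. 0 \<le> z k \<and> z k \<le> cap k}
    \<inter> (\<Inter>i\<in>N. {z. (\<Sum>j\<in>U. z (i, j)) \<le> r i}) \<inter> (\<Inter>j\<in>U. {z. (\<Sum>i\<in>N. z (i, j)) \<le> s j})"
  \<comment> \<open>\<open>B\<close> exceeds every \<open>r i / u i j\<close>. For positive utility,
    \<open>h\<close> has derivative \<open>2 * (B - v / u)\<close>, so it is strictly concave, and
    increasing up to \<open>v = r i\<close>. Where the utility is 0, division yields 0 and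
    \<open>cap\<close> forces \<open>z\<close> to vanish.\<close>
  define B where "B = 1 + (\<Sum>k\<in>N \<times> U. r (fst k) / u (fst k) (snd k))"
  define h where "h = (\<lambda>k v. 2 * B * v - v\<^sup>2 / u (fst k) (snd k))"
  define \<Psi> where "\<Psi> z = (\<Sum>k\<in>N \<times> U. h k (z k))" for z :: "'i \<times> 'j \<Rightarrow> real"
  have B: "r i / u i j < B" if "i \<in> N" "j \<in> U" for i j
    using member_le_sum[of "(i, j)" "N \<times> U" "\<lambda>k. r (fst k) / u (fst k) (snd k)"] that fin u r
    by (auto simp: B_def)
  have cl: "closed {z :: 'i \<times> 'j \<Rightarrow> real. (\<Sum>i\<in>A. z (g i)) \<le> b}" for A b and g :: "'k \<Rightarrow> _"
    by (intro closed_Collect_le continuous_on_sum continuous_on_proj continuous_on_const)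
  have "compact K"
    unfolding K_def by (intro compact_Int_closed compact_box closed_INT ballI cl)
  moreover have "(\<lambda>_. 0) \<in> K" using r s by (auto simp: K_def cap_def)
  then have "K \<noteq> {}" by blast
  moreover have "continuous_on K \<Psi>"
    unfolding \<Psi>_def h_def divide_inverse by (intro continuous_intros continuous_on_proj)
  ultimately have "\<exists>z\<in>K. \<forall>y\<in>K. \<Psi> y \<le> \<Psi> z" by (rule continuous_attains_sup)
  then obtain z where z: "z \<in> K" "\<And>y. y \<in> K \<Longrightarrow> \<Psi> y \<le> \<Psi> z" by blast
  have z0: "z k \<ge> 0" and zcap: "z k \<le> cap k" for k
    using z(1) unfolding K_def by blast+
  have row: "(\<Sum>j\<in>U. z (i, j)) \<le> r i" if "i \<in> N" for i using z(1) that by (auto simp: K_def)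
  have col: "(\<Sum>i\<in>N. z (i, j)) \<le> s j" if "j \<in> U" for j using z(1) that by (auto simp: K_def)
  have finNU: "finite (N \<times> U)" using fin by simp
  \<comment> \<open>The bound by \<open>cap\<close> follows from the other conditions, since an
    entry is at most its row sum.\<close>
  have KI: "y \<in> K"
    if y0: "\<And>k. 0 \<le> y k"
      and supp: "\<And>i j. \<not> (i \<in> N \<and> j \<in> U \<and> u i j > 0) \<Longrightarrow> y (i, j) = 0"
      and rows: "\<And>i. i \<in> N \<Longrightarrow> (\<Sum>j\<in>U. y (i, j)) \<le> r i"
      and cols: "\<And>j. j \<in> U \<Longrightarrow> (\<Sum>i\<in>N. y (i, j)) \<le> s j" for y
  proof -
    have "y (i, j) \<le> cap (i, j)" for i j
    proof (cases "i \<in> N \<and> j \<in> U \<and> u i j > 0")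
      case True
      then have "y (i, j) \<le> (\<Sum>j\<in>U. y (i, j))"
        by (intro member_le_sum[of j U "\<lambda>j. y (i, j)"] y0 fin) auto
      also have "\<dots> \<le> r i" using True rows by blast
      finally show ?thesis using True by (simp add: cap_def)
    next
      case False
      then show ?thesis using supp[OF False] by (auto simp: cap_def)
    qed
    then have "\<forall>k. 0 \<le> y k \<and> y k \<le> cap k" using y0 by force
    then show ?thesis using rows cols unfolding K_def by blast
  qed
  have zz: "z (i, j) = 0" if "\<not> (i \<in> N \<and> j \<in> U \<and> u i j > 0)" for i j
    using z0[of "(i, j)"] zcap[of "(i, j)"] that unfolding cap_def by (simp split: if_splits)
  have full: "(\<Sum>j\<in>U. z (i, j)) = r i"
    if i: "i \<in> N" and c: "c \<in> U" and slack: "(\<Sum>i\<in>N. z (i, c)) < s c" and uc: "u i c > 0" for i c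
  proof (rule ccontr)
    assume "\<not> ?thesis"
    then have less: "(\<Sum>j\<in>U. z (i, j)) < r i" using row[OF i] by simp
    define \<delta> where "\<delta> = min (r i - (\<Sum>j\<in>U. z (i, j))) (s c - (\<Sum>i\<in>N. z (i, c)))"
    have d: "\<delta> > 0" using less slack by (simp add: \<delta>_def)
    define y where "y = z((i, c) := z (i, c) + \<delta>)"
    have "y \<in> K"
    proof (rule KI)
      show "(\<Sum>j\<in>U. y (i', j)) \<le> r i'" if "i' \<in> N" for i'
      proof (cases "i' = i")
        case True
        have "(\<Sum>j\<in>U. y (i', j)) = (\<Sum>j\<in>U. ((\<lambda>j. z (i, j))(c := z (i, c) + \<delta>)) j)"
          by (intro sum.cong) (auto simp: y_def True)
        also have "\<dots> = (\<Sum>j\<in>U. z (i, j)) + \<delta>"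
          using sum_fun_upd1[OF fin(2) c, of "\<lambda>_ v. v"] by simp
        finally show ?thesis by (simp add: \<delta>_def True)
      qed (use row[OF that] in \<open>simp add: y_def\<close>)
      show "(\<Sum>i\<in>N. y (i, j)) \<le> s j" if "j \<in> U" for j
      proof (cases "j = c")
        case True
        have "(\<Sum>i\<in>N. y (i, j)) = (\<Sum>i'\<in>N. ((\<lambda>i. z (i, c))(i := z (i, c) + \<delta>)) i')"
          by (intro sum.cong) (auto simp: y_def True)
        also have "\<dots> = (\<Sum>i\<in>N. z (i, c)) + \<delta>"
          using sum_fun_upd1[OF fin(1) i, of "\<lambda>_ v. v"] by simp
        finally show ?thesis by (simp add: \<delta>_def True)
      qed (use col[OF that] in \<open>simp add: y_def\<close>)
      show "0 \<le> y k" for k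
        using z0[of k] z0[of "(i, c)"] d by (cases "k = (i, c)") (simp_all add: y_def)
      show "y (i', j) = 0" if "\<not> (i' \<in> N \<and> j \<in> U \<and> u i' j > 0)" for i' j
        using zz[OF that] that i c uc by (cases "(i', j) = (i, c)") (auto simp: y_def)
    qed
    then have "\<Psi> y \<le> \<Psi> z" by (rule z(2))
    moreover have "\<Psi> y = \<Psi> z + (h (i, c) (z (i, c) + \<delta>) - h (i, c) (z (i, c)))"
      unfolding \<Psi>_def y_def using i c by (intro sum_fun_upd1 finNU) auto
    moreover have "h (i, c) (z (i, c) + \<delta>) - h (i, c) (z (i, c)) = \<delta> * (2 * B - (2 * z (i, c) + \<delta>) / u i c)"
      using uc by (simp add: h_def field_simps power2_eq_square)
    \<comment> \<open>The new entry is at most \<open>r i\<close>, where \<open>B\<close> still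
      dominates the ratio: spending more raises the potential.\<close>
    moreover have "0 < \<delta> * (2 * B - (2 * z (i, c) + \<delta>) / u i c)"
    proof (rule mult_pos_pos[OF d])
      have "z (i, c) \<le> (\<Sum>j\<in>U. z (i, j))"
        using member_le_sum[of c U "\<lambda>j. z (i, j)"] c z0 fin by simp
      then have "z (i, c) + \<delta> \<le> r i" unfolding \<delta>_def by linarith
      then have "2 * z (i, c) + \<delta> \<le> 2 * r i" using d r[OF i] z0[of "(i, c)"] by linarith
      then have "(2 * z (i, c) + \<delta>) / u i c \<le> 2 * (r i / u i c)"
        using divide_right_mono[of "2 * z (i, c) + \<delta>" "2 * r i" "u i c"] uc by simp
      then show "0 < 2 * B - (2 * z (i, c) + \<delta>) / u i c" using B[OF i c] by linarith
    qed
    ultimately show False by linarith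
  qed
  have even: "z (i, j) * u i c \<le> u i j * z (i, c)"
    if i: "i \<in> N" and c: "c \<in> U" and slack: "(\<Sum>i\<in>N. z (i, c)) < s c" and uc: "u i c > 0" and j: "j \<in> U" for i c j
  proof (rule ccontr)
    assume neg: "\<not> ?thesis"
    then have jc: "j \<noteq> c" by auto
    have uj: "u i j > 0" using neg zz[of i j] u[OF i j] z0[of "(i, c)"] by (cases "u i j = 0") auto
    have "z (i, c) / u i c < z (i, j) / u i j" using neg uc uj by (simp add: field_simps)
    then obtain \<delta> where d: "\<delta> > 0" "\<delta> \<le> s c - (\<Sum>i\<in>N. z (i, c))" "\<delta> \<le> z (i, j)"
        "(z (i, c) + \<delta>) / u i c \<le> (z (i, j) - \<delta>) / u i j"
      using small_transfer[OF uj uc, of "z (i, c)" "z (i, j)" "s c - (\<Sum>i\<in>N. z (i, c))"] z0 slack by auto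
    define y where "y = z((i, j) := z (i, j) - \<delta>, (i, c) := z (i, c) + \<delta>)"
    have "y \<in> K"
    proof (rule KI)
      show "(\<Sum>j\<in>U. y (i', j)) \<le> r i'" if "i' \<in> N" for i'
      proof (cases "i' = i")
        case True
        have "(\<Sum>j\<in>U. y (i', j)) = (\<Sum>j'\<in>U. ((\<lambda>j. z (i, j))(j := z (i, j) - \<delta>, c := z (i, c) + \<delta>)) j')"
          by (intro sum.cong) (auto simp: y_def True)
        also have "\<dots> = (\<Sum>j\<in>U. z (i, j))"
          using sum_fun_upd2[OF fin(2) j c jc, of "\<lambda>_ v. v"] by simp
        finally show ?thesis using row[OF i] True by simp
      qed (use row[OF that] in \<open>simp add: y_def\<close>)
      show "(\<Sum>i\<in>N. y (i, j')) \<le> s j'" if "j' \<in> U" for j'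
      proof (cases "j' = c")
        case True
        have "(\<Sum>i\<in>N. y (i, j')) = (\<Sum>i'\<in>N. ((\<lambda>i. z (i, c))(i := z (i, c) + \<delta>)) i')"
          by (intro sum.cong) (auto simp: y_def True)
        also have "\<dots> = (\<Sum>i\<in>N. z (i, c)) + \<delta>"
          using sum_fun_upd1[OF fin(1) i, of "\<lambda>_ v. v"] by simp
        finally show ?thesis using d True by simp
      next
        case False
        have "(\<Sum>i\<in>N. y (i, j')) \<le> (\<Sum>i\<in>N. z (i, j'))"
          using False d by (intro sum_mono) (auto simp: y_def)
        then show ?thesis using col[OF that] by simp
      qed
      show "0 \<le> y k" for k
        using z0[of k] z0[of "(i, c)"] d by (simp add: y_def)
      show "y (i', j') = 0" if "\<not> (i' \<in> N \<and> j' \<in> U \<and> u i' j' > 0)" for i' j'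
        using zz[OF that] that i j c uc uj by (cases "(i', j') = (i, c) \<or> (i', j') = (i, j)") (auto simp: y_def)
    qed
    then have "\<Psi> y \<le> \<Psi> z" by (rule z(2))
    moreover have "\<Psi> y = \<Psi> z + (h (i, j) (z (i, j) - \<delta>) - h (i, j) (z (i, j))) + (h (i, c) (z (i, c) + \<delta>) - h (i, c) (z (i, c)))"
      unfolding \<Psi>_def y_def using i j c jc by (intro sum_fun_upd2 finNU) auto
    \<comment> \<open>The row sum is kept, so the linear parts of the potential cancel; the
      subtracted quadratic part strictly decreases.\<close>
    ultimately show False
      using quadratic_transfer[OF uj uc d(1,4)] by (simp add: h_def algebra_simps)
  qed
  define e where "e = (\<lambda>i j. z (i, j))"
  show thesis
  proof (rule that)
    show "e i j \<ge> 0" for i j unfolding e_def by (rule z0)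
    show "e i j = 0" if "u i j = 0" for i j unfolding e_def by (rule zz) (simp add: that)
    show "(\<Sum>j\<in>U. e i j) \<le> r i" if "i \<in> N" for i unfolding e_def by (rule row[OF that])
    show "(\<Sum>i\<in>N. e i j) \<le> s j" if "j \<in> U" for j unfolding e_def by (rule col[OF that])
    show "(\<Sum>j\<in>U. e i j) = r i" if "i \<in> N" "c \<in> U" "(\<Sum>i\<in>N. e i c) < s c" "u i c > 0" for i c
      using full that unfolding e_def by blast
    show "e i j * u i c \<le> u i j * e i c"
      if "i \<in> N" "c \<in> U" "(\<Sum>i\<in>N. e i c) < s c" "u i c > 0" "j \<in> U" for i c j
      using even that unfolding e_def by blast
  qed
qed

section \<open>Payment systems\<close>

locale election =
  fixes C :: "'c set" and cost :: "'c \<Rightarrow> real" and n :: nat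
    and u :: "nat \<Rightarrow> 'c \<Rightarrow> real" and b :: real
  assumes finite_candidates: "finite C"
    and cost_pos: "\<And>c. c \<in> C \<Longrightarrow> cost c > 0"
    and voters: "n \<ge> 1"
    and util_range: "\<And>i c. i \<in> {1..n} \<Longrightarrow> c \<in> C \<Longrightarrow> 0 \<le> u i c \<and> u i c \<le> 1"
    and budget_pos: "b > 0"
begin

abbreviation wt :: "nat \<Rightarrow> 'c option \<Rightarrow> real" where "wt i \<equiv> case_option 1 (u i)"

abbreviation idx :: "'c set \<Rightarrow> nat \<Rightarrow> 'c option set" where "idx \<equiv> voter_index u"

text \<open>The cost of \<open>c\<close> in units of one voter's share \<open>b / n\<close>, so that
  every voter holds one unit of money.\<close>

definition q :: "'c \<Rightarrow> real" where "q c = real n * cost c / b"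

text \<open>A payment system as one function with \<open>r\<^sub>i = z (i, None)\<close> and \<open>p\<^sub>i(c) = z (i, Some c)\<close>,
  forced to vanish wherever its values carry no meaning, so that these form a compact set.\<close>

definition payments :: "'c set \<Rightarrow> (nat \<times> 'c option \<Rightarrow> real) set" where
  "payments W = {z. (\<forall>k. 0 \<le> z k) \<and> (\<forall>i j. \<not> (i \<in> {1..n} \<and> j \<in> idx W i) \<longrightarrow> z (i, j) = 0) \<and>
     (\<forall>i\<in>{1..n}. (\<Sum>j\<in>idx W i. z (i, j)) = 1) \<and> (\<forall>c\<in>W. (\<Sum>i\<in>{1..n}. z (i, Some c)) \<le> q c)}"

definition total :: "'c set \<Rightarrow> (nat \<times> 'c option \<Rightarrow> real) \<Rightarrow> real" where
  "total W z = (\<Sum>i\<in>{1..n}. harmonic_entropy (idx W i) (wt i) (\<lambda>j. z (i, j)))"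

lemma q_pos: "c \<in> C \<Longrightarrow> q c > 0"
  using cost_pos voters budget_pos by (simp add: q_def)

lemma sum_q: "sum q A = real n / b * cost_of cost A"
  by (simp add: q_def cost_of_def sum_distrib_left)

lemma finite_sub: "W \<subseteq> C \<Longrightarrow> finite W"
  using finite_candidates by (rule rev_finite_subset)

lemma finite_idx: "W \<subseteq> C \<Longrightarrow> finite (idx W i)"
  using finite_sub by (simp add: voter_index_def)

lemma Some_in_idx: "Some c \<in> idx W i \<longleftrightarrow> c \<in> W \<and> u i c > 0"
  by (auto simp: voter_index_def)

lemma None_in_idx: "None \<in> idx W i"
  by (simp add: voter_index_def)

lemma weights_idx: "W \<subseteq> C \<Longrightarrow> weights (idx W i) (wt i)"
  using finite_idx by unfold_locales (auto simp: voter_index_def)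

lemma sum_idx:
  assumes "W \<subseteq> C" "i \<in> {1..n}" "\<And>c. c \<in> W \<Longrightarrow> u i c = 0 \<Longrightarrow> f (Some c) = 0"
  shows "(\<Sum>j\<in>idx W i. f j) = (f None + (\<Sum>c\<in>W. f (Some c)) :: real)"
proof -
  have "(\<Sum>c\<in>W. f (Some c)) = (\<Sum>c\<in>{c\<in>W. u i c > 0}. f (Some c))"
    using finite_sub[OF assms(1)] assms util_range[OF assms(2)]
    by (intro sum.mono_neutral_right) (auto simp: order.order_iff_strict subset_iff)
  also have "\<dots> = (\<Sum>j\<in>Some ` {c\<in>W. u i c > 0}. f j)"
    by (subst sum.reindex) auto
  finally show ?thesis using finite_sub[OF assms(1)] by (simp add: voter_index_def)
qed

lemma payments_nonneg: "z \<in> payments W \<Longrightarrow> 0 \<le> z k"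
  unfolding payments_def by blast

lemma payments_support: "z \<in> payments W \<Longrightarrow> \<not> (i \<in> {1..n} \<and> j \<in> idx W i) \<Longrightarrow> z (i, j) = 0"
  unfolding payments_def by blast

lemma payments_row: "z \<in> payments W \<Longrightarrow> i \<in> {1..n} \<Longrightarrow> (\<Sum>j\<in>idx W i. z (i, j)) = 1"
  unfolding payments_def by blast

lemma payments_cap: "z \<in> payments W \<Longrightarrow> c \<in> W \<Longrightarrow> (\<Sum>i\<in>{1..n}. z (i, Some c)) \<le> q c"
  unfolding payments_def by blast

lemma payments_budget:
  assumes "z \<in> payments W" "W \<subseteq> C" "i \<in> {1..n}"
  shows "z (i, None) + (\<Sum>c\<in>W. z (i, Some c)) = 1"
proof -
  have "z (i, Some c) = 0" if "c \<in> W" "u i c = 0" for c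
    using payments_support[OF assms(1), of i "Some c"] that by (simp add: Some_in_idx)
  then show ?thesis
    using payments_row[OF assms(1,3)] sum_idx[OF assms(2,3), of "\<lambda>j. z (i, j)"] by simp
qed

text \<open>Both descriptions attain the same values, so the \<open>GREATEST\<close> in the
  definition of \<open>entropy\<close> may be computed on the compact set
  \<open>payments W\<close>.\<close>

lemma entropy_eq:
  assumes W: "W \<subseteq> C"
  shows "(\<exists>(p, r)\<in>loose_payment_systems cost n u b W. e = (\<Sum>i\<in>{1..n}. voter_entropy u W p r i))
    \<longleftrightarrow> (\<exists>z\<in>payments W. e = total W z)" (is "?L \<longleftrightarrow> ?R")
proof
  assume ?L
  then obtain p r where pr: "(p, r) \<in> loose_payment_systems cost n u b W"
    and e: "e = (\<Sum>i\<in>{1..n}. voter_entropy u W p r i)" by blast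
  \<comment> \<open>Values of \<open>p\<close> and \<open>r\<close> without meaning are
    unconstrained in a loose payment system and are reset to 0.\<close>
  define z where "z = (\<lambda>(i, j). if i \<in> {1..n} \<and> j \<in> idx W i then case_option (r i) (p i) j else 0)"
  have zero: "p i c = 0" if "i \<in> {1..n}" "c \<in> W" "\<not> u i c > 0" for i c
    using pr that util_range[of i c] W unfolding loose_payment_systems_def
    by (auto simp: not_less intro: antisym)
  have "z \<in> payments W" unfolding payments_def
  proof (intro CollectI conjI allI ballI impI)
    show "0 \<le> z k" for k
      using pr by (cases k) (auto simp: z_def loose_payment_systems_def voter_index_def split: option.splits)
    show "z (i, j) = 0" if "\<not> (i \<in> {1..n} \<and> j \<in> idx W i)" for i j
      using that by (auto simp: z_def)
    fix i assume i: "i \<in> {1..n}"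
    have "(\<Sum>j\<in>idx W i. z (i, j)) = (\<Sum>j\<in>idx W i. case_option (r i) (p i) j)"
      using i by (intro sum.cong) (auto simp: z_def)
    also have "\<dots> = r i + (\<Sum>c\<in>W. p i c)" using zero[OF i] by (subst sum_idx[OF W i]) auto
    also have "\<dots> = 1" using pr i by (auto simp: loose_payment_systems_def)
    finally show "(\<Sum>j\<in>idx W i. z (i, j)) = 1" .
  next
    fix c assume c: "c \<in> W"
    have "(\<Sum>i\<in>{1..n}. z (i, Some c)) = (\<Sum>i\<in>{1..n}. p i c)"
      using c zero by (intro sum.cong) (auto simp: z_def Some_in_idx)
    also have "\<dots> \<le> q c" using pr c by (auto simp: loose_payment_systems_def q_def)
    finally show "(\<Sum>i\<in>{1..n}. z (i, Some c)) \<le> q c" .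
  qed
  moreover have "e = total W z"
    unfolding e total_def voter_entropy_def
    by (intro sum.cong refl weights.harmonic_entropy_cong[OF weights_idx[OF W]]) (auto simp: z_def)
  ultimately show ?R by blast
next
  assume ?R
  then obtain z where z: "z \<in> payments W" "e = total W z" by blast
  let ?p = "\<lambda>i c. z (i, Some c)" and ?r = "\<lambda>i. z (i, None)"
  have "(?p, ?r) \<in> loose_payment_systems cost n u b W"
    unfolding loose_payment_systems_def
  proof (intro CollectI case_prodI conjI ballI impI)
    show "?p i c = 0" if "u i c = 0" for i c
      using payments_support[OF z(1), of i "Some c"] that by (simp add: Some_in_idx)
  qed (use payments_nonneg[OF z(1)] payments_budget[OF z(1) W] payments_cap[OF z(1)] in \<open>auto simp: q_def\<close>)
  moreover have "case_option (?r i) (?p i) = (\<lambda>j. z (i, j))" for i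
    by (auto split: option.split)
  then have "e = (\<Sum>i\<in>{1..n}. voter_entropy u W ?p ?r i)"
    by (simp add: z total_def voter_entropy_def)
  ultimately show ?L by blast
qed

text \<open>Since each row sums to 1, every entry is at most 1; the remaining conditions are
  closed.\<close>

lemma compact_payments: "W \<subseteq> C \<Longrightarrow> compact (payments W)"
proof -
  assume W: "W \<subseteq> C"
  define B where "B = (\<lambda>(i, j). if i \<in> {1..n} \<and> j \<in> idx W i then 1 else 0 :: real)"
  have cl: "closed {z :: nat \<times> 'c option \<Rightarrow> real. (\<Sum>i\<in>A. z (g i)) \<le> b}"
    "closed {z :: nat \<times> 'c option \<Rightarrow> real. (\<Sum>i\<in>A. z (g i)) = b}" for A b and g :: "'k \<Rightarrow> _"
    by (intro closed_Collect_le closed_Collect_eq continuous_on_sum continuous_on_proj continuous_on_const)+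
  have "payments W = {z. \<forall>k. 0 \<le> z k \<and> z k \<le> B k}
    \<inter> (\<Inter>i\<in>{1..n}. {z. (\<Sum>j\<in>idx W i. z (i, j)) = 1}) \<inter> (\<Inter>c\<in>W. {z. (\<Sum>i\<in>{1..n}. z (i, Some c)) \<le> q c})"
    (is "_ = ?R")
  proof (intro equalityI subsetI)
    fix z assume z: "z \<in> payments W"
    have "z (i, j) \<le> B (i, j)" for i j
    proof (cases "i \<in> {1..n} \<and> j \<in> idx W i")
      case True
      then have "z (i, j) \<le> (\<Sum>j\<in>idx W i. z (i, j))"
        by (intro member_le_sum[of j "idx W i" "\<lambda>j. z (i, j)"] payments_nonneg[OF z] finite_idx[OF W]) auto
      then show ?thesis using True payments_row[OF z, of i] by (simp add: B_def)
    qed (use payments_support[OF z, of i j] in \<open>auto simp: B_def\<close>)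
    then have "\<forall>k. 0 \<le> z k \<and> z k \<le> B k" using payments_nonneg[OF z] by force
    then show "z \<in> ?R" using z unfolding payments_def by blast
  next
    fix z assume z: "z \<in> ?R"
    then have "\<forall>k. 0 \<le> z k \<and> z k \<le> B k" by blast
    then have "0 \<le> z k" "z k \<le> B k" for k by blast+
    moreover have "B (i, j) = 0" if "\<not> (i \<in> {1..n} \<and> j \<in> idx W i)" for i j
      using that by (auto simp: B_def)
    ultimately have "z (i, j) = 0" if "\<not> (i \<in> {1..n} \<and> j \<in> idx W i)" for i j
      using that by (metis order_antisym)
    then show "z \<in> payments W" using z unfolding payments_def by blast
  qed
  moreover have "compact \<dots>"
    by (intro compact_Int_closed compact_box closed_INT ballI cl)
  ultimately show ?thesis by simp
qed

lemma payments_nonempty: "W \<subseteq> C \<Longrightarrow> payments W \<noteq> {}"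
proof -
  assume W: "W \<subseteq> C"
  have "(\<Sum>j\<in>idx W i. if j = None then 1 else 0 :: real) = 1" for i
    using finite_idx[OF W] None_in_idx by simp
  \<comment> \<open>Nobody pays anything: every budget stays in the reserve.\<close>
  then have "(\<lambda>(i, j). if i \<in> {1..n} \<and> j = None then 1 else 0) \<in> payments W"
    using W q_pos unfolding payments_def by (auto simp: None_in_idx less_imp_le subset_iff)
  then show ?thesis by blast
qed

lemma continuous_on_total: "W \<subseteq> C \<Longrightarrow> continuous_on (payments W) (total W)"
  unfolding total_def
  by (intro continuous_on_sum weights.continuous_on_harmonic_entropy[OF weights_idx] continuous_on_proj)
    (auto simp: payments_nonneg payments_row)

lemma voter_distribution:
  assumes "z \<in> payments W" "i \<in> {1..n}"
  shows "\<And>j. j \<in> idx W i \<Longrightarrow> 0 \<le> z (i, j)" "(\<Sum>j\<in>idx W i. z (i, j)) = 1"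
  using payments_nonneg[OF assms(1)] payments_row[OF assms] by auto

text \<open>Among the maximizers of \<open>total\<close>, one minimizing the quadratic
  \<open>Q\<close> is taken. A transfer to a lower ratio keeps it a maximizer and decreases
  \<open>Q\<close>, so no such transfer can be feasible. The reserve can always receive money, a
  candidate whenever it is not fully paid for.\<close>

lemma balanced_optimum:
  assumes W: "W \<subseteq> C"
  obtains z where "z \<in> payments W" "entropy cost n u b W = total W z"
    "\<And>y. y \<in> payments W \<Longrightarrow> total W y \<le> entropy cost n u b W"
    "\<And>i c. i \<in> {1..n} \<Longrightarrow> c \<in> W \<Longrightarrow> z (i, Some c) \<le> z (i, None) * u i c"
    "\<And>i c. i \<in> {1..n} \<Longrightarrow> c \<in> W \<Longrightarrow> (\<Sum>i\<in>{1..n}. z (i, Some c)) < q c \<Longrightarrow>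
      z (i, Some c) = z (i, None) * u i c"
proof -
  define A where "A = Sigma {1..n} (idx W)"
  define Q where "Q z = (\<Sum>k\<in>A. (z k)\<^sup>2 / wt (fst k) (snd k))" for z
  have finA: "finite A" unfolding A_def using finite_idx[OF W] by blast
  have "continuous_on (payments W) Q"
    unfolding Q_def divide_inverse by (intro continuous_intros continuous_on_proj)
  from lexicographic_optimum[OF compact_payments[OF W] payments_nonempty[OF W] continuous_on_total[OF W] this]
  obtain z where z: "z \<in> payments W" and opt: "\<And>y. y \<in> payments W \<Longrightarrow> total W y \<le> total W z"
    and Q: "\<And>y. y \<in> payments W \<Longrightarrow> total W y = total W z \<Longrightarrow> Q z \<le> Q y" by blast
  have ent: "entropy cost n u b W = total W z"
    unfolding entropy_def entropy_eq[OF W] using z opt by (intro Greatest_equality) auto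
  \<comment> \<open>Taking the reserve for \<open>k\<close> yields the upper bound on payments;
    taking it for \<open>j\<close> yields equality at candidates with slack.\<close>
  have ratio: "z (i, j) / wt i j \<le> z (i, k) / wt i k"
    if i: "i \<in> {1..n}" and jk: "j \<in> idx W i" "k \<in> idx W i"
      and slack: "\<And>c. k = Some c \<Longrightarrow> (\<Sum>i\<in>{1..n}. z (i, Some c)) < q c" for i j k
  proof (rule ccontr)
    interpret weights "idx W i" "wt i" by (rule weights_idx[OF W])
    assume "\<not> ?thesis"
    then have less: "z (i, k) / wt i k < z (i, j) / wt i j" by simp
    then have ne: "j \<noteq> k" by auto
    \<comment> \<open>The capacity left at \<open>k\<close>; the reserve has no cap, so any positive
      value serves there.\<close>
    define \<epsilon> where "\<epsilon> = (case k of None \<Rightarrow> 1 | Some c \<Rightarrow> q c - (\<Sum>i\<in>{1..n}. z (i, Some c)))"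
    have "\<epsilon> > 0" using slack by (auto simp: \<epsilon>_def split: option.split)
    from small_transfer[OF pos[OF jk(1)] pos[OF jk(2)] less payments_nonneg[OF z] this]
    obtain \<delta> where d: "\<delta> > 0" "\<delta> \<le> \<epsilon>" "\<delta> \<le> z (i, j)" "(z (i, k) + \<delta>) / wt i k \<le> (z (i, j) - \<delta>) / wt i j"
      by blast
    define y where "y = z((i, j) := z (i, j) - \<delta>, (i, k) := z (i, k) + \<delta>)"
    have yi: "(\<lambda>j'. y (i, j')) = (\<lambda>j. z (i, j))(j := z (i, j) - \<delta>, k := z (i, k) + \<delta>)"
      by (auto simp: y_def)
    have yi': "(\<lambda>j'. y (i', j')) = (\<lambda>j. z (i', j))" if "i' \<noteq> i" for i'
      using that by (auto simp: y_def)
    have y: "y \<in> payments W" unfolding payments_def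
    proof (intro CollectI conjI allI ballI impI)
      show "0 \<le> y k'" for k'
        using payments_nonneg[OF z] d by (simp add: y_def)
      show "y (i', j') = 0" if "\<not> (i' \<in> {1..n} \<and> j' \<in> idx W i')" for i' j'
        using payments_support[OF z that] that i jk by (auto simp: y_def)
      show "(\<Sum>j'\<in>idx W i'. y (i', j')) = 1" if i': "i' \<in> {1..n}" for i'
      proof (cases "i' = i")
        case True
        have "(\<Sum>j'\<in>idx W i. y (i, j')) = (\<Sum>j'\<in>idx W i. z (i, j'))"
          unfolding yi using sum_fun_upd2[OF fin jk ne, of "\<lambda>_ v. v"] by simp
        then show ?thesis using payments_row[OF z i] True by simp
      qed (use payments_row[OF z i'] in \<open>simp add: y_def\<close>)
    next
      fix c assume c: "c \<in> W"
      show "(\<Sum>i\<in>{1..n}. y (i, Some c)) \<le> q c"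
      proof (cases "k = Some c")
        case True
        have "(\<Sum>i'\<in>{1..n}. y (i', Some c)) = (\<Sum>i'\<in>{1..n}. ((\<lambda>i. z (i, Some c))(i := z (i, Some c) + \<delta>)) i')"
          using ne True by (intro sum.cong) (auto simp: y_def)
        also have "\<dots> = (\<Sum>i\<in>{1..n}. z (i, Some c)) + \<delta>"
          using sum_fun_upd1[of "{1..n}" i "\<lambda>_ v. v"] i by simp
        finally show ?thesis using d(2) True by (simp add: \<epsilon>_def)
      next
        case False
        have "(\<Sum>i\<in>{1..n}. y (i, Some c)) \<le> (\<Sum>i\<in>{1..n}. z (i, Some c))"
          using False d by (intro sum_mono) (auto simp: y_def)
        then show ?thesis using payments_cap[OF z c] by simp
      qed
    qed
    have "total W z \<le> total W y" unfolding total_def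
    proof (rule sum_mono)
      fix i' assume i': "i' \<in> {1..n}"
      show "harmonic_entropy (idx W i') (wt i') (\<lambda>j. z (i', j)) \<le> harmonic_entropy (idx W i') (wt i') (\<lambda>j. y (i', j))"
      proof (cases "i' = i")
        case True
        have "max_ratio (idx W i) (wt i) (\<lambda>j. y (i, j)) t \<le> max_ratio (idx W i) (wt i) (\<lambda>j. z (i, j)) t"
          if "t \<ge> 0" for t
          unfolding yi using that jk ne d voter_distribution[OF z i] by (intro max_ratio_transfer) auto
        then show ?thesis
          unfolding True by (intro harmonic_entropy_mono voter_distribution[OF z i] voter_distribution[OF y i])
      qed (simp add: yi')
    qed
    \<comment> \<open>By optimality of \<open>z\<close> the totals agree, so \<open>y\<close>
      competes with \<open>z\<close> in minimizing \<open>Q\<close>.\<close>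
    then have "Q z \<le> Q y" using opt[OF y] by (intro Q y antisym)
    moreover have "Q y = Q z + ((z (i, j) - \<delta>)\<^sup>2 / wt i j - (z (i, j))\<^sup>2 / wt i j) + ((z (i, k) + \<delta>)\<^sup>2 / wt i k - (z (i, k))\<^sup>2 / wt i k)"
      unfolding Q_def y_def using i jk ne
      by (subst sum_fun_upd2[OF finA, of _ _ "\<lambda>k v. v\<^sup>2 / wt (fst k) (snd k)"]) (auto simp: A_def cong: option.case_cong)
    ultimately show False
      using quadratic_transfer[OF pos[OF jk(1)] pos[OF jk(2)] d(1,4)] by simp
  qed
  have zero: "z (i, Some c) = 0" if "u i c = 0" for i c
    using payments_support[OF z, of i "Some c"] that by (simp add: Some_in_idx)
  have le: "z (i, Some c) \<le> z (i, None) * u i c" if i: "i \<in> {1..n}" and c: "c \<in> W" for i c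
  proof (cases "u i c = 0")
    case False
    then have uc: "u i c > 0" using util_range[OF i, of c] c W by auto
    then have "z (i, Some c) / u i c \<le> z (i, None)"
      using ratio[OF i, of "Some c" None] c by (simp add: Some_in_idx None_in_idx)
    then show ?thesis using uc by (simp add: field_simps)
  qed (simp add: zero)
  have eq: "z (i, Some c) = z (i, None) * u i c"
    if i: "i \<in> {1..n}" and c: "c \<in> W" and slack: "(\<Sum>i\<in>{1..n}. z (i, Some c)) < q c" for i c
  proof (cases "u i c = 0")
    case False
    then have uc: "u i c > 0" using util_range[OF i, of c] c W by auto
    then have "z (i, None) \<le> z (i, Some c) / u i c"
      using ratio[OF i, of None "Some c"] c slack by (simp add: Some_in_idx None_in_idx)
    then have "z (i, None) * u i c \<le> z (i, Some c)" using uc by (simp add: field_simps)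
    then show ?thesis using le[OF i c] by simp
  qed (simp add: zero)
  show thesis
    using that[OF z ent] opt le eq unfolding ent by blast
qed

lemma total_le_entropy:
  assumes "W \<subseteq> C" "z \<in> payments W"
  shows "total W z \<le> entropy cost n u b W"
  using balanced_optimum[OF assms(1)] assms(2) by metis

section \<open>Adding and removing a candidate\<close>

lemma idx_insert: "idx (insert c W) i = (if u i c > 0 then insert (Some c) (idx W i) else idx W i)"
  by (auto simp: voter_index_def)

lemma added_item_idx:
  assumes "W \<subseteq> C" "c \<in> C" "c \<notin> W" "i \<in> {1..n}" "u i c > 0"
  shows "added_item (idx W i) (Some c) (wt i)"
proof -
  interpret weights "insert (Some c) (idx W i)" "wt i"
    using weights_idx[of "insert c W" i] assms by (simp add: idx_insert)
  show ?thesis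
    using assms util_range[of i c] by unfold_locales (auto simp: voter_index_def)
qed

text \<open>Every voter with positive utility for \<open>c\<close> pays the money above the level
  f_u, \<open>u = u i c\<close>, scaled by a common \<open>\<theta>\<close> that respects the price.
  The gain is at least \<open>\<theta> * G\<close>, and \<open>G\<close> dominates both the price
  and the unscaled payments \<open>P\<close>.\<close>

lemma entropy_insert:
  assumes W: "W \<subseteq> C" and c: "c \<in> C" "c \<notin> W" and z: "z \<in> payments W"
    and demand: "q c \<le> (\<Sum>i\<in>{1..n}. z (i, None) * u i c)"
  shows "total W z + q c \<le> entropy cost n u b (insert c W)"
proof -
  let ?x = "\<lambda>i j. z (i, j)"
  define f where "f i t = max_ratio (idx W i) (wt i) (?x i) t" for i t
  define G where "G = (\<Sum>i\<in>{1..n}. u i c * f i 0)"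
  define P where "P = (\<Sum>i\<in>{1..n}. f i (u i c) * u i c)"
  \<comment> \<open>The largest fraction at most 1 for which the payments
    \<open>\<theta> * P\<close> do not exceed the price.\<close>
  define \<theta> where "\<theta> = (if P \<le> q c then 1 else q c / P)"
  define y where "y = (\<lambda>(i, j). if i \<in> {1..n} \<and> u i c > 0
    then if j \<in> idx (insert c W) i
      then \<theta> * added_item.pay (idx W i) (Some c) (wt i) (?x i) j + (1 - \<theta>) * ((?x i)(Some c := 0)) j else 0
    else z (i, j))"
  have qc: "q c > 0" using q_pos c by simp
  have th: "0 \<le> \<theta>" "\<theta> \<le> 1" "\<theta> * P \<le> q c" using qc by (auto simp: \<theta>_def)
  have uc: "0 \<le> u i c" if "i \<in> {1..n}" for i using util_range c that by blast
  have PG: "P \<le> G" unfolding P_def G_def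
  proof (rule sum_mono)
    fix i assume i: "i \<in> {1..n}"
    have "f i (u i c) \<le> f i 0" unfolding f_def
      using uc[OF i] voter_distribution[OF z i]
      by (intro weights.max_ratio_antimono[OF weights_idx[OF W]]) auto
    then show "f i (u i c) * u i c \<le> u i c * f i 0"
      using mult_left_mono[OF _ uc[OF i]] by (simp add: mult.commute[of _ "u i c"])
  qed
  \<comment> \<open>The reserve has weight 1, so it is one of the ratios under the maximum
    f_0.\<close>
  have "(\<Sum>i\<in>{1..n}. z (i, None) * u i c) \<le> G" unfolding G_def
  proof (rule sum_mono)
    fix i assume i: "i \<in> {1..n}"
    have "z (i, None) \<le> f i 0" unfolding f_def
      using weights.elem_le_max_ratio[OF weights_idx[OF W], of 0 None i "?x i"] None_in_idx by simp
    then show "z (i, None) * u i c \<le> u i c * f i 0"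
      using mult_left_mono[OF _ uc[OF i]] by (simp add: mult.commute[of _ "u i c"])
  qed
  then have qG: "q c \<le> G" using demand by simp
  \<comment> \<open>Without scaling the gain is \<open>G\<close>; with scaling it is
    \<open>q c * G / P\<close>, and \<open>P \<le> G\<close>.\<close>
  have gain: "q c \<le> \<theta> * G"
  proof (cases "P \<le> q c")
    case False
    then have "q c * P \<le> q c * G" "P > 0" using PG qc by (auto intro: mult_left_mono)
    then show ?thesis using False by (simp add: \<theta>_def field_simps)
  qed (use qG in \<open>simp add: \<theta>_def\<close>)
  have zc: "z (i, Some c) = 0" for i using payments_support[OF z, of i "Some c"] c by (simp add: Some_in_idx)
  have voter:
    "harmonic_entropy (idx W i) (wt i) (?x i) + \<theta> * (u i c * f i 0)
      \<le> harmonic_entropy (idx (insert c W) i) (wt i) (\<lambda>j. y (i, j))"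
    "\<And>j. 0 \<le> y (i, j)" "(\<Sum>j\<in>idx (insert c W) i. y (i, j)) = 1"
    "\<And>j. j \<in> idx W i \<Longrightarrow> y (i, j) \<le> z (i, j)"
    "y (i, Some c) = \<theta> * (f i (u i c) * u i c)"
    if i: "i \<in> {1..n}" for i
  proof -
    have "(harmonic_entropy (idx W i) (wt i) (?x i) + \<theta> * (u i c * f i 0)
      \<le> harmonic_entropy (idx (insert c W) i) (wt i) (\<lambda>j. y (i, j))) \<and>
    (\<forall>j. 0 \<le> y (i, j)) \<and> (\<Sum>j\<in>idx (insert c W) i. y (i, j)) = 1 \<and>
    (\<forall>j. j \<in> idx W i \<longrightarrow> y (i, j) \<le> z (i, j)) \<and>
    y (i, Some c) = \<theta> * (f i (u i c) * u i c)"
    proof (cases "u i c > 0")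
      case False
      then have u0: "u i c = 0" using uc[OF i] by simp
      then have "y (i, j) = z (i, j)" for j by (simp add: y_def)
      then show ?thesis
        using u0 zc payments_row[OF z i] payments_nonneg[OF z] by (simp add: idx_insert)
    next
      case True
      interpret added_item "idx W i" "Some c" "wt i" by (rule added_item_idx[OF W c i True])
      let ?y = "\<lambda>j. \<theta> * pay (?x i) j + (1 - \<theta>) * ((?x i)(Some c := 0)) j"
      have idx: "idx (insert c W) i = insert (Some c) (idx W i)" using True by (simp add: idx_insert)
      have eq: "y (i, j) = ?y j" if "j \<in> insert (Some c) (idx W i)" for j
        using i True that by (simp add: y_def idx)
      note g = harmonic_entropy_gain[where x = "?x i", OF payments_nonneg[OF z] payments_row[OF z i] th(1,2)]
      have "harmonic_entropy (insert (Some c) (idx W i)) (wt i) ?y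
          = harmonic_entropy (insert (Some c) (idx W i)) (wt i) (\<lambda>j. y (i, j))"
        by (intro harmonic_entropy_cong eq[symmetric])
      moreover have "(\<Sum>j\<in>insert (Some c) (idx W i). y (i, j)) = (\<Sum>j\<in>insert (Some c) (idx W i). ?y j)"
        by (intro sum.cong refl eq)
      moreover have "0 \<le> y (i, j)" for j
      proof (cases "j \<in> insert (Some c) (idx W i)")
        case j: True
        then show ?thesis using g(2)[OF j] eq[OF j] by simp
      qed (use i True in \<open>simp add: y_def idx\<close>)
      moreover have "y (i, Some c) = \<theta> * (f i (u i c) * u i c)"
        using eq[of "Some c"] pay_new[of "?x i"] by (simp add: f_def)
      moreover have "y (i, j) \<le> z (i, j)" if "j \<in> idx W i" for j
        using g(4)[OF that] eq[of j] that by simp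
      ultimately show ?thesis
        using g(1,3) unfolding idx f_def by simp
    qed
    then show
      "harmonic_entropy (idx W i) (wt i) (?x i) + \<theta> * (u i c * f i 0)
        \<le> harmonic_entropy (idx (insert c W) i) (wt i) (\<lambda>j. y (i, j))"
      "\<And>j. 0 \<le> y (i, j)" "(\<Sum>j\<in>idx (insert c W) i. y (i, j)) = 1"
      "\<And>j. j \<in> idx W i \<Longrightarrow> y (i, j) \<le> z (i, j)"
      "y (i, Some c) = \<theta> * (f i (u i c) * u i c)"
      by blast+
  qed
  have out: "y (i, j) = 0" if "\<not> (i \<in> {1..n} \<and> j \<in> idx (insert c W) i)" for i j
    using that payments_support[OF z, of i j] by (auto simp: y_def idx_insert)
  have "y \<in> payments (insert c W)" unfolding payments_def
  proof (intro CollectI conjI allI ballI impI)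
    show "0 \<le> y k" for k
    proof (cases k)
      case (Pair i j)
      then show ?thesis using voter(2)[of i j] out[of i j] by (cases "i \<in> {1..n}") auto
    qed
    fix c' assume c': "c' \<in> insert c W"
    show "(\<Sum>i\<in>{1..n}. y (i, Some c')) \<le> q c'"
    proof (cases "c' = c")
      case True
      have "(\<Sum>i\<in>{1..n}. y (i, Some c)) = \<theta> * P"
        unfolding P_def sum_distrib_left using voter(5) by (intro sum.cong) auto
      then show ?thesis using th(3) True by simp
    next
      case False
      have "(\<Sum>i\<in>{1..n}. y (i, Some c')) \<le> (\<Sum>i\<in>{1..n}. z (i, Some c'))"
      proof (rule sum_mono)
        fix i assume i: "i \<in> {1..n}"
        show "y (i, Some c') \<le> z (i, Some c')"
        proof (cases "Some c' \<in> idx W i")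
          case notin: False
          then have "y (i, Some c') = 0" using False by (intro out) (auto simp: Some_in_idx)
          then show ?thesis using payments_nonneg[OF z] by simp
        qed (use voter(4)[OF i] in auto)
      qed
      then show ?thesis using payments_cap[OF z, of c'] False c' by simp
    qed
  qed (use voter(3) out in auto)
  then have "total (insert c W) y \<le> entropy cost n u b (insert c W)"
    using W c by (intro total_le_entropy) auto
  moreover have "total W z + \<theta> * G \<le> total (insert c W) y"
    unfolding total_def G_def sum_distrib_left sum.distrib[symmetric] by (intro sum_mono voter(1))
  ultimately show ?thesis using gain by simp
qed

text \<open>\<open>y\<close> refunds the payments for \<open>c\<close> to the reserve and to
  candidates at the top ratio, which is the reserve itself. Each voter then loses at most the old
  payment plus the rise \<open>m i\<close> allowed for the top ratio.\<close>

lemma entropy_remove: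
  assumes W: "insert c W \<subseteq> C" "c \<notin> W" and z: "z \<in> payments (insert c W)"
    and top: "\<And>i d. i \<in> {1..n} \<Longrightarrow> d \<in> W \<Longrightarrow> z (i, Some d) \<le> z (i, None) * u i d"
      "\<And>i. i \<in> {1..n} \<Longrightarrow> z (i, Some c) = z (i, None) * u i c"
    and y: "\<And>i j. i \<in> {1..n} \<Longrightarrow> j \<in> idx W i \<Longrightarrow> y i j \<ge> 0"
      "\<And>i j. i \<in> {1..n} \<Longrightarrow> j \<in> idx W i \<Longrightarrow> y i j \<noteq> 0 \<Longrightarrow> z (i, j) = z (i, None) * wt i j"
      "\<And>i. i \<in> {1..n} \<Longrightarrow> (\<Sum>j\<in>idx W i. y i j) = z (i, Some c)"
    and m: "\<And>i j. i \<in> {1..n} \<Longrightarrow> j \<in> idx W i \<Longrightarrow> y i j \<le> m i * wt i j"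
      "\<And>i. i \<in> {1..n} \<Longrightarrow> m i \<ge> 0"
    and cap: "\<And>d. d \<in> W \<Longrightarrow> (\<Sum>i\<in>{1..n}. z (i, Some d) + (if u i d > 0 then y i (Some d) else 0)) \<le> q d"
  shows "total (insert c W) z \<le> entropy cost n u b W + (\<Sum>i\<in>{1..n}. z (i, Some c) + m i)"
proof -
  have WC: "W \<subseteq> C" "c \<in> C" using W by auto
  define x where "x = (\<lambda>(i, j). if i \<in> {1..n} \<and> j \<in> idx W i then z (i, j) + y i j else 0)"
  have voter: "(\<Sum>j\<in>idx W i. x (i, j)) = 1"
    "harmonic_entropy (idx (insert c W) i) (wt i) (\<lambda>j. z (i, j))
      \<le> harmonic_entropy (idx W i) (wt i) (\<lambda>j. x (i, j)) + (z (i, Some c) + m i)"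
    if i: "i \<in> {1..n}" for i
  proof -
    have xeq: "harmonic_entropy (idx W i) (wt i) (\<lambda>j. x (i, j)) = harmonic_entropy (idx W i) (wt i) (\<lambda>j. z (i, j) + y i j)"
      by (intro weights.harmonic_entropy_cong[OF weights_idx[OF WC(1)]]) (use i in \<open>auto simp: x_def\<close>)
    have sumx: "(\<Sum>j\<in>idx W i. x (i, j)) = (\<Sum>j\<in>idx W i. z (i, j)) + z (i, Some c)"
      using y(3)[OF i] i by (simp add: x_def sum.distrib)
    have "(\<Sum>j\<in>idx W i. x (i, j)) = 1 \<and>
      harmonic_entropy (idx (insert c W) i) (wt i) (\<lambda>j. z (i, j))
      \<le> harmonic_entropy (idx W i) (wt i) (\<lambda>j. x (i, j)) + (z (i, Some c) + m i)"
    proof (cases "u i c > 0")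
      case False
      then have zc: "z (i, Some c) = 0" using payments_support[OF z, of i "Some c"] by (simp add: Some_in_idx)
      \<comment> \<open>A voter without utility for \<open>c\<close> paid nothing, so the
        nonnegative refunds sum to 0.\<close>
      have "\<forall>j\<in>idx W i. y i j = 0"
        using y(3)[OF i] y(1)[OF i] finite_idx[OF WC(1), of i] unfolding zc
        by (subst (asm) sum_nonneg_eq_0_iff) auto
      then have "harmonic_entropy (idx W i) (wt i) (\<lambda>j. z (i, j) + y i j) = harmonic_entropy (idx W i) (wt i) (\<lambda>j. z (i, j))"
        by (intro weights.harmonic_entropy_cong[OF weights_idx[OF WC(1)]]) simp
      then show ?thesis
        using False xeq sumx zc payments_row[OF z i] m(2)[OF i] by (simp add: idx_insert)
    next
      case True
      interpret added_item "idx W i" "Some c" "wt i" by (rule added_item_idx[OF WC W(2) i True])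
      have idx: "idx (insert c W) i = insert (Some c) (idx W i)" using True by (simp add: idx_insert)
      have "harmonic_entropy (insert (Some c) (idx W i)) (wt i) (\<lambda>j. z (i, j))
        \<le> harmonic_entropy (idx W i) (wt i) (\<lambda>j. z (i, j) + y i j) + (z (i, Some c) + m i)"
      proof (rule harmonic_entropy_loss[where \<rho> = "z (i, None)"])
        show "z (i, j) \<le> z (i, None) * wt i j" if "j \<in> idx W i" for j
          using that top(1)[OF i] by (cases j) (auto simp: Some_in_idx)
        show "z (i, Some c) = z (i, None) * wt i (Some c)" using top(2)[OF i] by simp
      qed (use voter_distribution[OF z i] y m i idx in auto)
      then show ?thesis
        using sumx payments_row[OF z i] xeq unfolding idx sum_insert by simp
    qed
    then show "(\<Sum>j\<in>idx W i. x (i, j)) = 1"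
      "harmonic_entropy (idx (insert c W) i) (wt i) (\<lambda>j. z (i, j))
        \<le> harmonic_entropy (idx W i) (wt i) (\<lambda>j. x (i, j)) + (z (i, Some c) + m i)"
      by blast+
  qed
  have "x \<in> payments W" unfolding payments_def
  proof (intro CollectI conjI allI ballI impI)
    show "0 \<le> x k" for k
      using payments_nonneg[OF z] y(1) by (cases k) (auto simp: x_def)
    fix d assume d: "d \<in> W"
    have "(\<Sum>i\<in>{1..n}. x (i, Some d)) \<le> (\<Sum>i\<in>{1..n}. z (i, Some d) + (if u i d > 0 then y i (Some d) else 0))"
      using payments_nonneg[OF z] d by (intro sum_mono) (auto simp: x_def Some_in_idx)
    then show "(\<Sum>i\<in>{1..n}. x (i, Some d)) \<le> q d" using cap[OF d] by simp
  qed (use voter(1) in \<open>auto simp: x_def\<close>)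
  then have "total W x \<le> entropy cost n u b W" by (intro total_le_entropy WC)
  moreover have "total (insert c W) z \<le> total W x + (\<Sum>i\<in>{1..n}. z (i, Some c) + m i)"
    unfolding total_def sum.distrib[symmetric] using voter(2) by (intro sum_mono) auto
  ultimately show ?thesis by simp
qed

section \<open>Feasibility and the core\<close>

lemma cost_le_budget:
  assumes W: "W \<subseteq> C"
    and opt: "\<And>c. c \<in> W \<Longrightarrow> entropy cost n u b (W - {c}) + q c \<le> entropy cost n u b W"
  shows "cost_of cost W \<le> b"
proof (rule ccontr)
  assume "\<not> ?thesis"
  then have "real n < real n / b * cost_of cost W"
    using budget_pos voters by (simp add: field_simps)
  then have over: "real n < sum q W" by (simp add: sum_q)
  obtain z where z: "z \<in> payments W" and ent: "entropy cost n u b W = total W z"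
    and top: "\<And>i c. i \<in> {1..n} \<Longrightarrow> c \<in> W \<Longrightarrow> z (i, Some c) \<le> z (i, None) * u i c"
    and eq: "\<And>i c. i \<in> {1..n} \<Longrightarrow> c \<in> W \<Longrightarrow> (\<Sum>i\<in>{1..n}. z (i, Some c)) < q c \<Longrightarrow>
      z (i, Some c) = z (i, None) * u i c"
    using balanced_optimum[OF W] by metis
  define s where "s c = q c - (\<Sum>i\<in>{1..n}. z (i, Some c))" for c
  define U where "U = {c\<in>W. s c > 0}"
  have U: "U \<subseteq> W" "finite U" using finite_sub[OF W] by (auto simp: U_def)
  have s0: "s c \<ge> 0" if "c \<in> W" for c using payments_cap[OF z that] by (simp add: s_def)
  \<comment> \<open>Reserves and payments add up to \<open>n\<close>, which is less than
    \<open>sum q W\<close>; so the unpaid costs exceed the reserves in total.\<close>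
  have "(\<Sum>i\<in>{1..n}. z (i, None)) = (\<Sum>i\<in>{1..n}. 1 - (\<Sum>c\<in>W. z (i, Some c)))"
    using payments_budget[OF z W] by (intro sum.cong) (auto simp: algebra_simps)
  also have "\<dots> = real n - (\<Sum>c\<in>W. \<Sum>i\<in>{1..n}. z (i, Some c))"
    by (simp add: sum_subtractf) (rule sum.swap)
  also have "\<dots> < sum s W" using over by (simp add: s_def sum_subtractf)
  also have "sum s W = sum s U"
    using finite_sub[OF W] s0 by (intro sum.mono_neutral_right) (force simp: U_def)+
  finally have less: "(\<Sum>i\<in>{1..n}. z (i, None)) < sum s U" .
  have uU: "u i c \<ge> 0" "u i c \<le> 1" if "i \<in> {1..n}" "c \<in> U" for i c
    using util_range that U W by auto
  obtain e where e0: "\<And>i j. e i j \<ge> 0"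
    and eu: "\<And>i j. i \<in> {1..n} \<Longrightarrow> j \<in> U \<Longrightarrow> u i j = 0 \<Longrightarrow> e i j = 0"
    and row: "\<And>i. i \<in> {1..n} \<Longrightarrow> (\<Sum>j\<in>U. e i j) \<le> z (i, None)"
    and col: "\<And>j. j \<in> U \<Longrightarrow> (\<Sum>i\<in>{1..n}. e i j) \<le> s j"
    and full: "\<And>i c. i \<in> {1..n} \<Longrightarrow> c \<in> U \<Longrightarrow> (\<Sum>i\<in>{1..n}. e i c) < s c \<Longrightarrow> u i c > 0 \<Longrightarrow> (\<Sum>j\<in>U. e i j) = z (i, None)"
    and even: "\<And>i c j. i \<in> {1..n} \<Longrightarrow> c \<in> U \<Longrightarrow> (\<Sum>i\<in>{1..n}. e i c) < s c \<Longrightarrow> u i c > 0 \<Longrightarrow> j \<in> U \<Longrightarrow>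
      e i j * u i c \<le> u i j * e i c"
    by (rule balanced_allocation[of "{1..n}" U u "\<lambda>i. z (i, None)" s])
      (use U uU s0 payments_nonneg[OF z] in auto)
  \<comment> \<open>Filling every unpaid cost would take more money than the reserves hold.\<close>
  have "\<exists>c\<in>U. (\<Sum>i\<in>{1..n}. e i c) < s c"
  proof (rule ccontr)
    assume "\<not> ?thesis"
    then have "sum s U \<le> (\<Sum>c\<in>U. \<Sum>i\<in>{1..n}. e i c)" by (intro sum_mono) (auto simp: not_less)
    also have "\<dots> = (\<Sum>i\<in>{1..n}. \<Sum>c\<in>U. e i c)" by (rule sum.swap)
    also have "\<dots> \<le> (\<Sum>i\<in>{1..n}. z (i, None))" by (intro sum_mono row)
    finally show False using less by simp
  qed
  then obtain c where c: "c \<in> U" "(\<Sum>i\<in>{1..n}. e i c) < s c" by blast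
  define V where "V = W - {c}"
  have WV: "W = insert c V" "c \<notin> V" "V \<subseteq> C" using c U W by (auto simp: V_def)
  \<comment> \<open>The refund follows \<open>e i\<close> scaled by \<open>u i c\<close>; the share
    intended for the removed \<open>c\<close> goes to the reserve. As \<open>e i\<close> spends the
    full reserve when \<open>u i c > 0\<close>, the refund totals
    \<open>z (i, None) * u i c\<close>, the payment for \<open>c\<close>.\<close>
  define y where "y i j = (case j of None \<Rightarrow> u i c * e i c | Some d \<Rightarrow> if d \<in> U then u i c * e i d else 0)" for i j
  have slack: "(\<Sum>i\<in>{1..n}. z (i, Some d)) < q d" if "d \<in> U" for d using that by (simp add: U_def s_def)
  have "total (insert c V) z \<le> entropy cost n u b V + (\<Sum>i\<in>{1..n}. z (i, Some c) + e i c)"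
  proof (rule entropy_remove[where y = y])
    fix i assume i: "i \<in> {1..n}"
    show "z (i, Some d) \<le> z (i, None) * u i d" if "d \<in> V" for d using top i that WV by auto
    show zc: "z (i, Some c) = z (i, None) * u i c" using eq[OF i _ slack[OF c(1)]] WV by auto
    show "0 \<le> y i j" for j
      using uU[OF i c(1)] e0 by (auto simp: y_def split: option.split)
    show "z (i, j) = z (i, None) * wt i j" if "y i j \<noteq> 0" for j
    proof (cases j)
      case (Some d)
      then have "d \<in> U" using that by (auto simp: y_def split: if_splits)
      then show ?thesis using eq[OF i _ slack] U Some by auto
    qed simp
    show "(\<Sum>j\<in>idx V i. y i j) = z (i, Some c)"
    proof -
      have "(\<Sum>j\<in>idx V i. y i j) = y i None + (\<Sum>d\<in>V. y i (Some d))"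
        using eu[OF i] by (intro sum_idx WV i) (auto simp: y_def)
      also have "(\<Sum>d\<in>V. y i (Some d)) = (\<Sum>d\<in>U - {c}. u i c * e i d)"
        unfolding y_def using finite_sub[OF WV(3)] U
        by (intro sum.mono_neutral_cong_right) (auto simp: V_def)
      also have "y i None + \<dots> = (\<Sum>d\<in>U. u i c * e i d)"
        using U c by (simp add: y_def sum.remove)
      also have "\<dots> = u i c * (\<Sum>d\<in>U. e i d)" by (simp add: sum_distrib_left)
      also have "\<dots> = z (i, None) * u i c"
        using full[OF i c] uU[OF i c(1)] by (cases "u i c = 0") auto
      finally show ?thesis by (simp add: zc)
    qed
    \<comment> \<open>The balance of \<open>e\<close> bounds the refund at candidates;
      \<open>u i c \<le> 1\<close> bounds it at the reserve.\<close>
    show "y i j \<le> e i c * wt i j" if "j \<in> idx V i" for j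
    proof (cases "u i c = 0")
      case True
      then show ?thesis using that e0[of i c] by (cases j) (auto simp: y_def Some_in_idx)
    next
      case False
      then have uc: "u i c > 0" using uU[OF i c(1)] by simp
      show ?thesis
      proof (cases j)
        case None
        have "u i c * e i c \<le> 1 * e i c" using uU[OF i c(1)] e0 by (intro mult_right_mono) auto
        then show ?thesis using None by (simp add: y_def)
      next
        case (Some d)
        then show ?thesis
          using even[OF i c uc, of d] that e0[of i c] by (auto simp: y_def Some_in_idx mult.commute)
      qed
    qed
    show "e i c \<ge> 0" by (rule e0)
  next
    fix d assume d: "d \<in> V"
    show "(\<Sum>i\<in>{1..n}. z (i, Some d) + (if u i d > 0 then y i (Some d) else 0)) \<le> q d"
    proof (cases "d \<in> U")
      case True
      \<comment> \<open>Because \<open>u i c \<le> 1\<close>, the refunds at \<open>d\<close> are at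
        most the amounts \<open>e i d\<close>, which fit into the unpaid cost
        \<open>s d\<close>.\<close>
      have "(\<Sum>i\<in>{1..n}. z (i, Some d) + (if u i d > 0 then y i (Some d) else 0))
          \<le> (\<Sum>i\<in>{1..n}. z (i, Some d) + e i d)"
        using True e0 uU c by (intro sum_mono) (auto simp: y_def intro: mult_left_le_one_le)
      also have "\<dots> \<le> q d" using col[OF True] by (simp add: s_def sum.distrib)
      finally show ?thesis .
    next
      case False
      then have "y i (Some d) = 0" for i by (simp add: y_def)
      then show ?thesis using payments_cap[OF z, of d] d WV(1) by (simp cong: if_cong)
    qed
  qed (use WV W z in auto)
  \<comment> \<open>The choice of \<open>c\<close> enters here: its share of the reserves is less
    than \<open>s c\<close>, so the total loss is less than \<open>q c\<close>.\<close>
  also have "\<dots> < entropy cost n u b V + q c" using c(2) by (simp add: s_def sum.distrib)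
  also have "\<dots> \<le> entropy cost n u b W" using opt[of c] c U by (auto simp: V_def)
  finally show False using ent unfolding WV(1)[symmetric] by simp
qed

lemma no_deviation:
  assumes W: "W \<subseteq> C"
    and opt: "\<And>c. c \<in> C \<Longrightarrow> c \<notin> W \<Longrightarrow> entropy cost n u b (insert c W) < entropy cost n u b W + q c"
    and S: "S \<subseteq> {1..n}" "S \<noteq> {}" and T: "T \<subseteq> C" and aff: "sum q T \<le> real (card S)"
  shows "\<exists>i\<in>S. util u i T < util u i W + 1"
proof (rule ccontr)
  assume "\<not> ?thesis"
  then have dev: "util u i W + 1 \<le> util u i T" if "i \<in> S" for i using that by (auto simp: not_less)
  obtain z where z: "z \<in> payments W" and ent: "entropy cost n u b W = total W z"
    and top: "\<And>i c. i \<in> {1..n} \<Longrightarrow> c \<in> W \<Longrightarrow> z (i, Some c) \<le> z (i, None) * u i c"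
    using balanced_optimum[OF W] by metis
  have fin: "finite W" "finite T" using finite_sub W T by auto
  have demand: "(\<Sum>i\<in>{1..n}. z (i, None) * u i c) < q c" if "c \<in> T - W" for c
    using entropy_insert[OF W _ _ z, of c] opt[of c] that T ent by force
  \<comment> \<open>With the reserve as price per unit of utility, the lead of 1 in utility pays for
    the reserve itself, and the rest of \<open>u i (T - W)\<close> covers the payments for
    \<open>W - T\<close>. Hence \<open>T\<close> absorbs at least the whole budget of
    \<open>i\<close>.\<close>
  have share: "1 \<le> (\<Sum>c\<in>T - W. z (i, None) * u i c) + (\<Sum>c\<in>T \<inter> W. z (i, Some c))" if i: "i \<in> S" for i
  proof -
    have iN: "i \<in> {1..n}" using i S by auto
    have "1 = z (i, None) + (\<Sum>c\<in>W - T. z (i, Some c)) + (\<Sum>c\<in>T \<inter> W. z (i, Some c))"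
      using payments_budget[OF z W iN] sum.Int_Diff[OF fin(1), of "\<lambda>c. z (i, Some c)" T]
      by (simp add: Int_commute)
    also have "(\<Sum>c\<in>W - T. z (i, Some c)) \<le> (\<Sum>c\<in>W - T. z (i, None) * u i c)"
      using top[OF iN] by (intro sum_mono) auto
    also have "z (i, None) + (\<Sum>c\<in>W - T. z (i, None) * u i c) = z (i, None) * (1 + (\<Sum>c\<in>W - T. u i c))"
      by (simp add: sum_distrib_left algebra_simps)
    also have "\<dots> \<le> z (i, None) * (\<Sum>c\<in>T - W. u i c)"
    proof (intro mult_left_mono payments_nonneg[OF z])
      show "1 + (\<Sum>c\<in>W - T. u i c) \<le> (\<Sum>c\<in>T - W. u i c)"
        using dev[OF i] sum.Int_Diff[OF fin(1), of "u i" T] sum.Int_Diff[OF fin(2), of "u i" W]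
        by (simp add: util_def Int_commute)
    qed
    finally show ?thesis by (simp add: sum_distrib_left)
  qed
  \<comment> \<open>The demand bound is strict only outside \<open>W\<close>, so the final
    contradiction requires such a candidate in \<open>T\<close>.\<close>
  have ne: "T - W \<noteq> {}"
  proof
    assume "T - W = {}"
    then have TW: "T \<subseteq> W" by blast
    obtain i where i: "i \<in> S" using S by blast
    have "i \<in> {1..n}" using i S by blast
    then have "0 \<le> u i c" if "c \<in> W" for c using util_range[of i c] W that by blast
    then have "util u i T \<le> util u i W"
      unfolding util_def using TW fin by (intro sum_mono2) auto
    then show False using dev[OF i] by simp
  qed
  have bound: "(\<Sum>i\<in>S. g i) \<le> (\<Sum>i\<in>{1..n}. g i)" if "\<And>i. i \<in> {1..n} \<Longrightarrow> g i \<ge> 0" for g :: "nat \<Rightarrow> real"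
    using S that by (intro sum_mono2) auto
  have "real (card S) \<le> (\<Sum>i\<in>S. (\<Sum>c\<in>T - W. z (i, None) * u i c) + (\<Sum>c\<in>T \<inter> W. z (i, Some c)))"
    using sum_mono[of S "\<lambda>_. 1 :: real", OF share] by simp
  also have "\<dots> = (\<Sum>c\<in>T - W. \<Sum>i\<in>S. z (i, None) * u i c) + (\<Sum>c\<in>T \<inter> W. \<Sum>i\<in>S. z (i, Some c))"
    by (simp add: sum.distrib sum.swap[of _ S])
  also have "\<dots> \<le> (\<Sum>c\<in>T - W. \<Sum>i\<in>{1..n}. z (i, None) * u i c) + (\<Sum>c\<in>T \<inter> W. \<Sum>i\<in>{1..n}. z (i, Some c))"
    using payments_nonneg[OF z] util_range T by (intro add_mono sum_mono bound mult_nonneg_nonneg) auto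
  also have "\<dots> < sum q (T - W) + sum q (T \<inter> W)"
    using fin ne demand payments_cap[OF z] by (intro add_less_le_mono sum_strict_mono sum_mono) auto
  also have "\<dots> = sum q T" using sum.Int_Diff[OF fin(2), of q W] by simp
  finally show False using aff by simp
qed

lemma score_insert:
  assumes "finite W" "c \<notin> W"
  shows "score cost n u b (insert c W)
    = entropy cost n u b (insert c W) - entropy cost n u b W - q c + score cost n u b W"
  using assms sum_q[of "insert c W"] sum_q[of W] by (simp add: score_def)

end

theorem theorem1:
  fixes C :: "'c set" and cost :: "'c \<Rightarrow> real" and n :: nat
    and u :: "nat \<Rightarrow> 'c \<Rightarrow> real" and b :: real and W :: "'c set"
  assumes "finite C" and "C \<noteq> {}"
    and "\<And>c. c \<in> C \<Longrightarrow> cost c > 0"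
    and "n \<ge> 1"
    and "\<And>i c. i \<in> {1..n} \<Longrightarrow> c \<in> C \<Longrightarrow> 0 \<le> u i c \<and> u i c \<le> 1"
    and "\<And>i. i \<in> {1..n} \<Longrightarrow> \<exists>c\<in>C. u i c > 0"
    and "b > 0"
    and "W \<in> max_payment_entropy_rule C cost n u b"
  shows "core_up_to_one C cost n u b W"
proof -
  interpret election C cost n u b by unfold_locales (fact assms)+
  have W: "W \<subseteq> C" and max: "\<And>V. V \<subseteq> C \<Longrightarrow> score cost n u b V \<le> score cost n u b W"
    and tie: "\<And>V. V \<in> score_maximizers C cost n u b \<Longrightarrow> cost_of cost V \<le> cost_of cost W"
    using assms(8) by (auto simp: max_payment_entropy_rule_def score_maximizers_def)
  have fin: "finite W" by (rule finite_sub[OF W])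
  \<comment> \<open>Strictness comes from tie-breaking: otherwise \<open>insert c W\<close> would
    also be a maximizer, of larger cost because \<open>cost c > 0\<close>.\<close>
  have add: "entropy cost n u b (insert c W) < entropy cost n u b W + q c" if c: "c \<in> C" "c \<notin> W" for c
  proof (rule ccontr)
    assume "\<not> ?thesis"
    then have "score cost n u b W \<le> score cost n u b (insert c W)"
      using score_insert[OF fin c(2)] by simp
    then have "score cost n u b V \<le> score cost n u b (insert c W)" if "V \<subseteq> C" for V
      using max[OF that] by linarith
    then have "insert c W \<in> score_maximizers C cost n u b"
      using W c by (simp add: score_maximizers_def)
    from tie[OF this] show False using fin c assms(3)[of c] by (simp add: cost_of_def)
  qed
  have remove: "entropy cost n u b (W - {c}) + q c \<le> entropy cost n u b W" if c: "c \<in> W" for c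
    using score_insert[of "W - {c}" c] max[OF order_trans[OF Diff_subset W], of "{c}"] fin c by (auto simp: insert_absorb)
  show ?thesis unfolding core_up_to_one_def
  proof (intro conjI allI impI)
    show "cost_of cost W \<le> b" by (rule cost_le_budget[OF W remove])
  next
    fix S T
    assume "S \<subseteq> {1..n}" "S \<noteq> {}" "T \<subseteq> C" and "cost_of cost T \<le> b * (real (card S) / real n)"
    moreover from this have "sum q T \<le> real (card S)"
      using assms(4,7) by (simp add: sum_q field_simps)
    ultimately show "\<exists>i\<in>S. util u i T < util u i W + 1"
      by (intro no_deviation[OF W add])
  qed
qed

end
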